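(* Let $n,d\in\mathbb{N}$, $s\in\{1,\ldots,d\}$, $\delta\in(0,1/4]$, $\sigma>0$ and $\Theta:=\{\theta\in\mathbb{R}^d:\|\theta\|_0\le s\}$. Assume that $X\in\mathbb{R}^{n\times d}$ is a (fixed) matrix such that each column of $X$ has Euclidean norm at most $\sqrt n$, and that $c,C>0$ are such that: when $d=1$, $\|X\|_2\ge c\sqrt n$; when $d\ge2$, $\vartheta(s\vee2,3)\ge c$ and $\max_{T\subseteq\{1,\ldots,d\}:|T|\le s\vee2}\|X_T\|_{\mathrm{op}}\le C\sqrt n$. For $\theta\in\Theta$, let $\mathcal{P}_\theta:=\{\mathsf{N}_n(X\theta,\sigma^2I_n)\}$. Then, setting $L(\theta,\theta'):=n^{-1}\|X(\theta-\theta')\|_2^2$, we have $$\mathcal{M}(\delta,\mathcal{P}_\Theta,L)\asymp_{c,C}\sigma^2\cdot\frac{s\log(ed/s)+\log(1/\delta)}{n}.$$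
   Context: $\|v\|_0$ is the number of non-zero entries of $v$; $a\vee b=\max(a,b)$; $\|\cdot\|_{\mathrm{op}}$ is the operator norm; $X_T\in\mathbb{R}^{n\times|T|}$ is the submatrix of $X$ obtained by extracting the columns with indices in $T$. Weighted restricted eigenvalue: for $v\in\mathbb{R}^d$ let $v^\sharp=(v_1^\sharp,\ldots,v_d^\sharp)^\top$ be the vector of absolute values of the components of $v$ arranged in decreasing order. For $j\in\{1,\ldots,d\}$ let $\lambda_j:=6\sigma\sqrt{n^{-1}\log(2d/j)}$. For $c_0>0$ and $s\in\{1,\ldots,d\}$ define $$\mathcal{C}_{\mathrm{WRE}}(s,c_0):=\Bigl\{v\in\mathbb{R}^d:\sum_{j=1}^d\lambda_jv_j^\sharp\le(1+c_0)\|v\|_2\Bigl(\sum_{j=1}^s\lambda_j^2\Bigr)^{1/2}\Bigr\},\qquad \vartheta(s,c_0):=\min_{v\in\mathcal{C}_{\mathrm{WRE}}(s,c_0)\setminus\{0\}}\frac{\|Xv\|_2}{n^{1/2}\|v\|_2}.$$ For a pseudo-metric space $\Theta$ of parameters (with its Borel $\sigma$-algebra), a family $\mathcal{P}_\Theta=\{\mathcal{P}_\theta:\theta\in\Theta\}$ where each $\mathcal{P}_\theta$ is a set of probability measures on a measurable space $\mathcal{X}$, and a loss $L:\Theta\times\Theta\to[0,\infty)$, the minimax $(1-\delta)$th quantile is $$\mathcal{M}(\delta,\mathcal{P}_\Theta,L):=\inf_{\hat\theta}\sup_{\theta\in\Theta}\sup_{P_\theta\in\mathcal{P}_\theta}\inf\{r\in[0,\infty):P_\theta\{L(\hat\theta,\theta)\le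 r\}\ge1-\delta\},$$ where the first infimum is over all measurable functions $\hat\theta:\mathcal{X}\to\Theta$ (which may depend on $\delta$ and on the known design $X$). Here $\mathcal{X}=\mathbb{R}^n$. $a\asymp_{c,C}b$ means that there are constants $k_1,k_2>0$ depending only on $c,C$ (and not on $n,d,s,\delta,\sigma,X$) with $k_1b\le a\le k_2b$. *)

theory Defs
  imports
    "HOL-Probability.Probability"
    "Jordan_Normal_Form.Matrix"
    "Jordan_Normal_Form.DL_Submatrix"
begin

unbundle no vec_syntax

text \<open>
  The dimensions are term-level natural numbers, because the constants of the result may not
  depend on them. Parameters and designs are vectors and matrices of
  \<^theory>\<open>Jordan_Normal_Form.Matrix\<close>, whose indices start at 0; the sample space
  of dimension n is the product space \<open>PiM {..<n} (\<lambda>_. borel)\<close>.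
\<close>

definition vnorm :: "real vec \<Rightarrow> real" where
  "vnorm v = L2_set (\<lambda>i. v $ i) {..<dim_vec v}"

definition vnorm0 :: "real vec \<Rightarrow> nat" where
  "vnorm0 v = card {i. i < dim_vec v \<and> v $ i \<noteq> 0}"

definition op_norm :: "real mat \<Rightarrow> real" where
  "op_norm A = (SUP v\<in>{v \<in> carrier_vec (dim_col A). vnorm v \<le> 1}. vnorm (A *\<^sub>v v))"

definition select_cols :: "real mat \<Rightarrow> nat set \<Rightarrow> real mat" where
  "select_cols A T = submatrix A UNIV T"


definition wre_weight :: "nat \<Rightarrow> nat \<Rightarrow> real \<Rightarrow> nat \<Rightarrow> real" where
  "wre_weight n d \<sigma> j = 6 * \<sigma> * sqrt (ln (2 * real d / real j) / real n)"

text \<open>\<open>sharp v j\<close> is the \<open>j\<close>-th largest absolute value of an entry,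
  counted from \<open>j = 1\<close>.\<close>

definition sharp :: "real vec \<Rightarrow> nat \<Rightarrow> real" where
  "sharp v j = rev (sort (map abs (list_of_vec v))) ! (j - 1)"

definition wre_cone :: "nat \<Rightarrow> nat \<Rightarrow> real \<Rightarrow> nat \<Rightarrow> real \<Rightarrow> real vec set" where
  "wre_cone n d \<sigma> s c0 = {v \<in> carrier_vec d.
     (\<Sum>j=1..d. wre_weight n d \<sigma> j * sharp v j)
       \<le> (1 + c0) * vnorm v * sqrt (\<Sum>j=1..s. (wre_weight n d \<sigma> j)\<^sup>2)}"

text \<open>
  For \<open>1 \<le> s \<le> d\<close>, \<open>c0 > 0\<close>, \<open>n \<ge> 1\<close> and \<open>\<sigma> > 0\<close> the infimum
  below is a minimum: the cone is closed, it contains the unit vectors, and the quotient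
  is continuous and invariant under scaling.
\<close>

definition wre_const :: "real mat \<Rightarrow> real \<Rightarrow> nat \<Rightarrow> real \<Rightarrow> real" where
  "wre_const X \<sigma> s c0 =
     (INF v\<in>wre_cone (dim_row X) (dim_col X) \<sigma> s c0 - {0\<^sub>v (dim_col X)}.
        vnorm (X *\<^sub>v v) / (sqrt (real (dim_row X)) * vnorm v))"


text \<open>The Borel sigma-algebra of the pseudo-metric space \<open>(\<Theta>, \<rho>)\<close>.\<close>

definition pm_borel :: "'p set \<Rightarrow> ('p \<Rightarrow> 'p \<Rightarrow> real) \<Rightarrow> 'p measure" where
  "pm_borel \<Theta> \<rho> =
     sigma \<Theta> {U. U \<subseteq> \<Theta> \<and> (\<forall>x\<in>U. \<exists>e>0. \<forall>y\<in>\<Theta>. \<rho> x y < e \<longrightarrow> y \<in> U)}"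

text \<open>
  The value is extended because the set of admissible \<open>r\<close> may be empty and the supremum
  may be infinite. \<open>S\<close> is the sample space (only its sigma-algebra is used) and
  \<open>\<P> \<theta>\<close> is the set of probability measures belonging to \<open>\<theta>\<close>.
\<close>

definition minimax_quantile ::
  "real \<Rightarrow> 'x measure \<Rightarrow> 'p set \<Rightarrow> ('p \<Rightarrow> 'p \<Rightarrow> real) \<Rightarrow> ('p \<Rightarrow> 'x measure set)
     \<Rightarrow> ('p \<Rightarrow> 'p \<Rightarrow> real) \<Rightarrow> ennreal" where
  "minimax_quantile \<delta> S \<Theta> \<rho> \<P> L =
     (INF est\<in>measurable S (pm_borel \<Theta> \<rho>). SUP \<theta>\<in>\<Theta>. SUP P\<in>\<P> \<theta>.
        INF r\<in>{r::real. 0 \<le> r \<and> measure P {x \<in> space P. L (est x) \<theta> \<le> r} \<ge> 1 - \<delta>}.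
          ennreal r)"


text \<open>The normal distribution with mean \<open>\<mu>\<close> and covariance matrix
  \<open>\<sigma>\<^sup>2 I\<close>: independent coordinates with standard deviation \<open>\<sigma>\<close>.\<close>

definition normal_iso :: "real vec \<Rightarrow> real \<Rightarrow> (nat \<Rightarrow> real) measure" where
  "normal_iso \<mu> \<sigma> =
     PiM {..<dim_vec \<mu>} (\<lambda>i. density lborel (\<lambda>y. ennreal (normal_density (\<mu> $ i) \<sigma> y)))"

definition sparse_vecs :: "nat \<Rightarrow> nat \<Rightarrow> real vec set" where
  "sparse_vecs d s = {\<theta> \<in> carrier_vec d. vnorm0 \<theta> \<le> s}"

definition pred_loss :: "real mat \<Rightarrow> real vec \<Rightarrow> real vec \<Rightarrow> real" where
  "pred_loss X \<theta> \<theta>' = (vnorm (X *\<^sub>v (\<theta> - \<theta>')))\<^sup>2 / real (dim_row X)"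

text \<open>The parameter set carries the Euclidean metric.\<close>

definition sparse_regression_quantile :: "real \<Rightarrow> real mat \<Rightarrow> nat \<Rightarrow> real \<Rightarrow> ennreal" where
  "sparse_regression_quantile \<delta> X s \<sigma> =
     minimax_quantile \<delta> (PiM {..<dim_row X} (\<lambda>_. borel)) (sparse_vecs (dim_col X) s)
       (\<lambda>\<theta> \<theta>'. vnorm (\<theta> - \<theta>')) (\<lambda>\<theta>. {normal_iso (X *\<^sub>v \<theta>) \<sigma>}) (pred_loss X)"

end

theory Submission
  imports Defs
begin

text \<open>
  On differences of \<open>s\<close>-sparse vectors, \<open>\<parallel>X v\<parallel>\<close> is comparable to
  \<open>sqrt n * \<parallel>v\<parallel>\<close>: the upper comparison is the assumption on the operator norms, the lower one
  holds because every \<open>2 s\<close>-sparse vector lies in the cone of the weighted restricted eigenvalue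
  (Cauchy-Schwarz and monotonicity of the weights).

  Upper bound: least squares over the sparse vectors, restricted to rational ones so that the
  estimator takes countably many values. Its loss is at most a constant times the maximum of
  \<open>\<Sum>j\<in>T. \<langle>X\<^sub>j, \<xi>\<rangle>\<^sup>2 / n\<^sup>2\<close> over the sets \<open>T\<close> of at most \<open>s\<close> columns, where
  \<open>\<xi>\<close> is the noise. The exponential moment of each such sum is bounded by decoupling with an
  independent Gaussian vector, and the union bound over the sets costs
  \<open>s * ln (e d / s)\<close>.

  Lower bound: if every quantile of the loss is below \<open>b\<close>, then the events that the estimator is
  close to \<open>\<theta>\<close> are disjoint for well separated \<open>\<theta>\<close>. By Cauchy-Schwarz applied to the
  likelihood ratio, \<open>P\<^sub>\<theta>(A)\<^sup>2 \<le> exp (\<parallel>X \<theta>\<parallel>\<^sup>2 / \<sigma>\<^sup>2) * P\<^sub>0(A)\<close>, so each of these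
  events is likely under the null law as well. With one nonzero hypothesis this gives the term
  \<open>ln (1 / \<delta>)\<close>. With the \<open>m^p\<close> vectors that have one entry \<open>a\<close> in each of \<open>p\<close> blocks of
  length \<open>m\<close> it gives \<open>p * ln m\<close>, since only few hypotheses lie in a common Hamming ball.
\<close>

subsection \<open>Gaussian product measures\<close>

abbreviation normal_measure :: "real \<Rightarrow> real \<Rightarrow> real measure" where
  "normal_measure m \<sigma> \<equiv> density lborel (\<lambda>y. ennreal (normal_density m \<sigma> y))"

abbreviation gauss :: "nat set \<Rightarrow> (nat \<Rightarrow> real) \<Rightarrow> real \<Rightarrow> (nat \<Rightarrow> real) measure" where
  "gauss I \<mu> \<sigma> \<equiv> PiM I (\<lambda>i. normal_measure (\<mu> i) \<sigma>)"

section \<open>Exponential moments of a single normal variable\<close>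

lemma nn_integral_normal_density:
  "0 < \<sigma> \<Longrightarrow> (\<integral>\<^sup>+ y. ennreal (normal_density m \<sigma> y) \<partial>lborel) = 1"
  by (subst nn_integral_eq_integral) auto

text \<open>Exponential tilting: completing the square turns the tilted density into a constant
  times the normal density with mean \<open>m + \<sigma>\<^sup>2 * a\<close>, and only the constant
  survives integration.\<close>

lemma normal_mgf:
  assumes "0 < \<sigma>"
  shows "(\<integral>\<^sup>+ y. ennreal (exp (a * (y - m))) \<partial>normal_measure m \<sigma>) = ennreal (exp (\<sigma>\<^sup>2 * a\<^sup>2 / 2))"
proof -
  have *: "normal_density m \<sigma> y * exp (a * (y - m))
      = exp (\<sigma>\<^sup>2 * a\<^sup>2 / 2) * normal_density (m + \<sigma>\<^sup>2 * a) \<sigma> y" for y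
  proof -
    have "- (y - m)\<^sup>2 / (2 * \<sigma>\<^sup>2) + a * (y - m)
        = \<sigma>\<^sup>2 * a\<^sup>2 / 2 + - (y - (m + \<sigma>\<^sup>2 * a))\<^sup>2 / (2 * \<sigma>\<^sup>2)"
      using assms by (simp add: field_simps power2_eq_square)
    then show ?thesis
      by (simp add: normal_density_def exp_add[symmetric] mult_exp_exp)
  qed
  have "(\<integral>\<^sup>+ y. ennreal (exp (a * (y - m))) \<partial>normal_measure m \<sigma>)
      = (\<integral>\<^sup>+ y. ennreal (exp (\<sigma>\<^sup>2 * a\<^sup>2 / 2)) * ennreal (normal_density (m + \<sigma>\<^sup>2 * a) \<sigma> y) \<partial>lborel)"
    by (subst nn_integral_density) (auto simp: * ennreal_mult'[symmetric] intro!: nn_integral_cong)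
  also have "\<dots> = ennreal (exp (\<sigma>\<^sup>2 * a\<^sup>2 / 2))"
    using assms by (subst nn_integral_cmult) (auto simp: nn_integral_normal_density)
  finally show ?thesis .
qed

text \<open>The factor \<open>exp (y\<^sup>2 / 4)\<close> halves the decay rate of the standard
  normal density, so the product is a multiple of the normal density with variance 2.\<close>

lemma std_normal_exp_square_quarter:
  "(\<integral>\<^sup>+ y. ennreal (exp (y\<^sup>2 / 4)) \<partial>normal_measure 0 1) = ennreal (sqrt 2)"
proof -
  have *: "normal_density 0 1 y * exp (y\<^sup>2 / 4) = sqrt 2 * normal_density 0 (sqrt 2) y" for y
    by (simp add: normal_density_def mult_exp_exp real_sqrt_mult real_div_sqrt field_simps)
  have "(\<integral>\<^sup>+ y. ennreal (exp (y\<^sup>2 / 4)) \<partial>normal_measure 0 1)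
      = (\<integral>\<^sup>+ y. ennreal (sqrt 2) * ennreal (normal_density 0 (sqrt 2) y) \<partial>lborel)"
    by (subst nn_integral_density) (auto simp: * ennreal_mult'[symmetric] intro!: nn_integral_cong)
  also have "\<dots> = ennreal (sqrt 2)"
    by (subst nn_integral_cmult) (auto simp: nn_integral_normal_density)
  finally show ?thesis .
qed

section \<open>Products of independent normal laws\<close>

lemma product_prob_space_normal:
  assumes "0 < \<sigma>"
  shows "product_prob_space (\<lambda>i. normal_measure (\<mu> i) \<sigma>)"
  using prob_space_normal_density[OF assms]
  by (auto simp: product_prob_space_def product_prob_space_axioms_def product_sigma_finite_def
        intro: prob_space_imp_sigma_finite)

lemma prob_space_gauss: "0 < \<sigma> \<Longrightarrow> prob_space (gauss I \<mu> \<sigma>)"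
  using prob_space_normal_density by (intro prob_space_PiM) auto

lemma sets_gauss: "sets (gauss I \<mu> \<sigma>) = sets (PiM I (\<lambda>_. borel))"
  by (intro sets_PiM_cong) auto

lemma measurable_gauss: "measurable (gauss I \<mu> \<sigma>) N = measurable (PiM I (\<lambda>_. borel)) N"
  by (intro measurable_cong_sets sets_gauss refl)

lemma space_gauss: "space (gauss I \<mu> \<sigma>) = space (PiM I (\<lambda>_. borel))"
  by (intro sets_eq_imp_space_eq sets_gauss)

lemma gauss_nn_integral_prod:
  assumes "0 < \<sigma>" "finite I" "\<And>i. i \<in> I \<Longrightarrow> f i \<in> borel_measurable borel"
  shows "(\<integral>\<^sup>+ y. (\<Prod>i\<in>I. f i (y i)) \<partial>gauss I \<mu> \<sigma>) = (\<Prod>i\<in>I. \<integral>\<^sup>+ y. f i y \<partial>normal_measure (\<mu> i) \<sigma>)"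
proof -
  interpret product_prob_space "\<lambda>i. normal_measure (\<mu> i) \<sigma>"
    by (rule product_prob_space_normal) fact
  show ?thesis using assms by (intro product_nn_integral_prod) auto
qed

lemma gauss_mgf:
  assumes "0 < \<sigma>" "finite I"
  shows "(\<integral>\<^sup>+ y. ennreal (exp (\<Sum>i\<in>I. a i * (y i - \<mu> i))) \<partial>gauss I \<mu> \<sigma>)
       = ennreal (exp (\<sigma>\<^sup>2 * (\<Sum>i\<in>I. (a i)\<^sup>2) / 2))"
proof -
  have "(\<integral>\<^sup>+ y. ennreal (exp (\<Sum>i\<in>I. a i * (y i - \<mu> i))) \<partial>gauss I \<mu> \<sigma>)
      = (\<integral>\<^sup>+ y. (\<Prod>i\<in>I. ennreal (exp (a i * (y i - \<mu> i)))) \<partial>gauss I \<mu> \<sigma>)"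
    using assms by (simp add: exp_sum prod_ennreal)
  also have "\<dots> = (\<Prod>i\<in>I. ennreal (exp (\<sigma>\<^sup>2 * (a i)\<^sup>2 / 2)))"
    using assms by (subst gauss_nn_integral_prod) (auto simp: normal_mgf)
  also have "\<dots> = ennreal (exp (\<sigma>\<^sup>2 * (\<Sum>i\<in>I. (a i)\<^sup>2) / 2))"
    using assms by (simp add: prod_ennreal exp_sum[symmetric] sum_distrib_left sum_divide_distrib)
  finally show ?thesis .
qed

text \<open>Decoupling: \<open>exp (\<Sum>j z\<^sub>j\<^sup>2 / 2)\<close> is the expectation of
  \<open>exp (\<Sum>j g\<^sub>j z\<^sub>j)\<close> over an independent standard Gaussian \<open>g\<close>, and for fixed
  \<open>g\<close> the inner exponent is linear in the sample.\<close>

lemma gauss_chaos_mgf: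
  fixes x :: "nat \<Rightarrow> nat \<Rightarrow> real"
  assumes \<sigma>: "0 < \<sigma>" and fin: "finite I" "finite J" and B: "0 < B"
    and op: "\<And>g. (\<Sum>i\<in>I. (\<Sum>j\<in>J. x i j * g j)\<^sup>2) \<le> B * (\<Sum>j\<in>J. (g j)\<^sup>2)"
  shows "(\<integral>\<^sup>+ y. ennreal (exp ((\<Sum>j\<in>J. (\<Sum>i\<in>I. x i j * (y i - \<mu> i))\<^sup>2) / (4 * \<sigma>\<^sup>2 * B))) \<partial>gauss I \<mu> \<sigma>)
      \<le> ennreal (sqrt 2 ^ card J)"
proof -
  \<comment> \<open>\<open>b\<close> scales the linear forms so that half of the sum of their
    squares is the exponent in the claim:
    \<open>b\<^sup>2 / 2 = 1 / (4 * \<sigma>\<^sup>2 * B)\<close>.\<close>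
  define b where "b = 1 / (\<sigma> * sqrt (2 * B))"
  have b2: "b\<^sup>2 = 1 / (2 * \<sigma>\<^sup>2 * B)"
    using B by (simp add: b_def power_divide power_mult_distrib)
  interpret G: prob_space "gauss J (\<lambda>_. 0) 1" by (rule prob_space_gauss) simp
  interpret N: prob_space "gauss I \<mu> \<sigma>" by (rule prob_space_gauss) fact
  interpret pair_sigma_finite "gauss J (\<lambda>_. 0) 1" "gauss I \<mu> \<sigma>" ..
  have eq: "ennreal (exp ((\<Sum>j\<in>J. (\<Sum>i\<in>I. x i j * (y i - \<mu> i))\<^sup>2) / (4 * \<sigma>\<^sup>2 * B)))
     = (\<integral>\<^sup>+ g. ennreal (exp (\<Sum>j\<in>J. (b * (\<Sum>i\<in>I. x i j * (y i - \<mu> i))) * (g j - 0))) \<partial>gauss J (\<lambda>_. 0) 1)" for y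
    by (subst gauss_mgf)
       (simp_all add: fin power_mult_distrib b2 sum_distrib_left[symmetric] sum_divide_distrib[symmetric] mult.commute)
  \<comment> \<open>Exchanging the sums exhibits the exponent as linear in \<open>y\<close> with
    coefficients depending on \<open>g\<close>, so \<open>gauss_mgf\<close> applies a second time,
    now to the sample.\<close>
  have swap: "(\<Sum>j\<in>J. (b * (\<Sum>i\<in>I. x i j * (y i - \<mu> i))) * (g j - 0))
     = (\<Sum>i\<in>I. (b * (\<Sum>j\<in>J. x i j * g j)) * (y i - \<mu> i))" for g y
    by (simp add: sum_distrib_left sum_distrib_right)
       (subst sum.swap, simp add: ac_simps)
  have "(\<integral>\<^sup>+ y. ennreal (exp ((\<Sum>j\<in>J. (\<Sum>i\<in>I. x i j * (y i - \<mu> i))\<^sup>2) / (4 * \<sigma>\<^sup>2 * B))) \<partial>gauss I \<mu> \<sigma>)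
    = (\<integral>\<^sup>+ g. (\<integral>\<^sup>+ y. ennreal (exp (\<Sum>j\<in>J. (b * (\<Sum>i\<in>I. x i j * (y i - \<mu> i))) * (g j - 0))) \<partial>gauss I \<mu> \<sigma>)
         \<partial>gauss J (\<lambda>_. 0) 1)"
    unfolding eq
    by (rule Fubini') measurable
  also have "\<dots> \<le> (\<integral>\<^sup>+ g. (\<Prod>j\<in>J. ennreal (exp ((g j)\<^sup>2 / 4))) \<partial>gauss J (\<lambda>_. 0) 1)"
  proof (rule nn_integral_mono)
    fix g
    have "(\<integral>\<^sup>+ y. ennreal (exp (\<Sum>j\<in>J. (b * (\<Sum>i\<in>I. x i j * (y i - \<mu> i))) * (g j - 0))) \<partial>gauss I \<mu> \<sigma>)
       = ennreal (exp (\<sigma>\<^sup>2 * (\<Sum>i\<in>I. (b * (\<Sum>j\<in>J. x i j * g j))\<^sup>2) / 2))"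
      unfolding swap by (rule gauss_mgf[OF \<sigma> fin(1)])
    also have "\<sigma>\<^sup>2 * (\<Sum>i\<in>I. (b * (\<Sum>j\<in>J. x i j * g j))\<^sup>2) / 2
       = (\<Sum>i\<in>I. (\<Sum>j\<in>J. x i j * g j)\<^sup>2) / (4 * B)"
      using \<sigma> B by (simp add: power_mult_distrib b2 sum_distrib_left[symmetric] sum_divide_distrib[symmetric])
    \<comment> \<open>By \<open>op\<close> each squared coordinate of \<open>g\<close> enters with
      the factor 1/4, below the critical 1/2, so the remaining Gaussian integral is finite.\<close>
    also have "ennreal (exp \<dots>) \<le> ennreal (exp ((\<Sum>j\<in>J. (g j)\<^sup>2) / 4))"
      using op[of g] B by (simp add: field_simps)
    also have "\<dots> = (\<Prod>j\<in>J. ennreal (exp ((g j)\<^sup>2 / 4)))"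
      using fin by (simp add: prod_ennreal exp_sum[symmetric] sum_divide_distrib)
    finally show "(\<integral>\<^sup>+ y. ennreal (exp (\<Sum>j\<in>J. (b * (\<Sum>i\<in>I. x i j * (y i - \<mu> i))) * (g j - 0))) \<partial>gauss I \<mu> \<sigma>)
       \<le> (\<Prod>j\<in>J. ennreal (exp ((g j)\<^sup>2 / 4)))" .
  qed
  also have "\<dots> = ennreal (sqrt 2 ^ card J)"
    using fin by (subst gauss_nn_integral_prod) (auto simp: std_normal_exp_square_quarter ennreal_power)
  finally show ?thesis .
qed

text \<open>The likelihood ratio factorises over the coordinates, so both measures give every box
  the same mass, and boxes determine a finite product of sigma-finite measures.\<close>

lemma gauss_eq_density:
  assumes \<sigma>: "0 < \<sigma>" and fin: "finite I"
  shows "gauss I \<mu> \<sigma> = density (gauss I (\<lambda>_. 0) \<sigma>)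
     (\<lambda>y. ennreal (exp (\<Sum>i\<in>I. (\<mu> i / \<sigma>\<^sup>2) * y i - (\<mu> i)\<^sup>2 / (2 * \<sigma>\<^sup>2))))"
proof -
  interpret M: product_prob_space "\<lambda>i. normal_measure (\<mu> i) \<sigma>"
    by (rule product_prob_space_normal) fact
  let ?L = "\<lambda>i y. exp ((\<mu> i / \<sigma>\<^sup>2) * y - (\<mu> i)\<^sup>2 / (2 * \<sigma>\<^sup>2))"
  let ?D = "density (gauss I (\<lambda>_. 0) \<sigma>)
     (\<lambda>y. ennreal (exp (\<Sum>i\<in>I. (\<mu> i / \<sigma>\<^sup>2) * y i - (\<mu> i)\<^sup>2 / (2 * \<sigma>\<^sup>2))))"
  have one: "(\<integral>\<^sup>+ y. ennreal (?L i y) * indicator A y \<partial>normal_measure 0 \<sigma>)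
      = emeasure (normal_measure (\<mu> i) \<sigma>) A" if "A \<in> sets borel" for i A
  proof -
    have "normal_density 0 \<sigma> y * ?L i y = normal_density (\<mu> i) \<sigma> y" for y
    proof -
      have "- y\<^sup>2 / (2 * \<sigma>\<^sup>2) + ((\<mu> i / \<sigma>\<^sup>2) * y - (\<mu> i)\<^sup>2 / (2 * \<sigma>\<^sup>2)) = - (y - \<mu> i)\<^sup>2 / (2 * \<sigma>\<^sup>2)"
        using \<sigma> by (simp add: field_simps power2_eq_square)
      then show ?thesis by (simp add: normal_density_def mult_exp_exp)
    qed
    then show ?thesis using that
      by (subst nn_integral_density)
         (auto simp: emeasure_density mult.assoc[symmetric] ennreal_mult'[symmetric])
  qed
  have "?D = gauss I \<mu> \<sigma>"
  proof (rule M.PiM_eqI)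
    show "sets ?D = sets (gauss I \<mu> \<sigma>)" by (simp add: sets_gauss)
    fix A assume A: "\<And>i. i \<in> I \<Longrightarrow> A i \<in> sets (normal_measure (\<mu> i) \<sigma>)"
    then have A': "\<And>i. i \<in> I \<Longrightarrow> A i \<in> sets borel" by simp
    have "Pi\<^sub>E I A \<in> sets (gauss I (\<lambda>_. 0) \<sigma>)"
      using A' fin by (intro sets_PiM_I_finite) auto
    then have "emeasure ?D (Pi\<^sub>E I A)
      = (\<integral>\<^sup>+ y. ennreal (exp (\<Sum>i\<in>I. (\<mu> i / \<sigma>\<^sup>2) * y i - (\<mu> i)\<^sup>2 / (2 * \<sigma>\<^sup>2))) * indicator (Pi\<^sub>E I A) y
          \<partial>gauss I (\<lambda>_. 0) \<sigma>)"
      by (subst emeasure_density) (auto simp: fin)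
    also have "\<dots> = (\<integral>\<^sup>+ y. (\<Prod>i\<in>I. ennreal (?L i (y i)) * indicator (A i) (y i)) \<partial>gauss I (\<lambda>_. 0) \<sigma>)"
    proof (rule nn_integral_cong)
      fix y assume "y \<in> space (gauss I (\<lambda>_. 0) \<sigma>)"
      \<comment> \<open>Membership in \<open>Pi\<^sub>E I A\<close> also demands the default value
        outside \<open>I\<close>, which points of the product space have.\<close>
      then have "y \<in> extensional I" by (simp add: space_PiM PiE_def)
      then have "indicator (Pi\<^sub>E I A) y = (\<Prod>i\<in>I. indicator (A i) (y i) :: ennreal)"
        using fin by (auto simp: indicator_def PiE_def Pi_iff)
      then show "ennreal (exp (\<Sum>i\<in>I. (\<mu> i / \<sigma>\<^sup>2) * y i - (\<mu> i)\<^sup>2 / (2 * \<sigma>\<^sup>2))) * indicator (Pi\<^sub>E I A) y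
        = (\<Prod>i\<in>I. ennreal (?L i (y i)) * indicator (A i) (y i))"
        using fin by (simp add: prod.distrib prod_ennreal exp_sum)
    qed
    also have "\<dots> = (\<Prod>i\<in>I. emeasure (normal_measure (\<mu> i) \<sigma>) (A i))"
      using A' \<sigma> fin by (subst gauss_nn_integral_prod) (auto simp: one simp del: times_divide_eq_left intro!: prod.cong)
    finally show "emeasure ?D (Pi\<^sub>E I A) = (\<Prod>i\<in>I. emeasure (normal_measure (\<mu> i) \<sigma>) (A i))" .
  qed (use fin in auto)
  then show ?thesis by simp
qed

text \<open>Cauchy-Schwarz for the integral of the likelihood ratio over \<open>A\<close>. The
  exponential factor is the second moment of that ratio under the centred law.\<close>

lemma gauss_change_of_mean:
  assumes \<sigma>: "0 < \<sigma>" and fin: "finite I" and A: "A \<in> sets (PiM I (\<lambda>_. borel))"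
  shows "(measure (gauss I \<mu> \<sigma>) A)\<^sup>2
     \<le> exp ((\<Sum>i\<in>I. (\<mu> i)\<^sup>2) / \<sigma>\<^sup>2) * measure (gauss I (\<lambda>_. 0) \<sigma>) A"
proof -
  let ?P = "gauss I \<mu> \<sigma>" and ?Q = "gauss I (\<lambda>_. 0) \<sigma>"
  let ?S = "(\<Sum>i\<in>I. (\<mu> i)\<^sup>2)"
  interpret P: prob_space ?P by (rule prob_space_gauss) fact
  interpret Q: prob_space ?Q by (rule prob_space_gauss) fact
  have A': "A \<in> sets ?Q" using A by (simp add: sets_gauss)
  define L where "L = (\<lambda>y. ennreal (exp (\<Sum>i\<in>I. (\<mu> i / \<sigma>\<^sup>2) * y i - (\<mu> i)\<^sup>2 / (2 * \<sigma>\<^sup>2))))"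
  have Lm: "L \<in> borel_measurable ?Q" unfolding L_def by measurable
  have L2: "(\<integral>\<^sup>+ y. (L y)\<^sup>2 \<partial>?Q) = ennreal (exp (?S / \<sigma>\<^sup>2))"
  proof -
    \<comment> \<open>The square of \<open>L\<close> is a constant times the exponential of a linear
      form, so \<open>gauss_mgf\<close> gives its mean; the exponents
      \<open>2 * ?S / \<sigma>\<^sup>2\<close> and \<open>- ?S / \<sigma>\<^sup>2\<close> add
      up.\<close>
    have lin: "(\<Sum>i\<in>I. (2 * \<mu> i / \<sigma>\<^sup>2) * (y i - 0)) = 2 * (\<Sum>i\<in>I. (\<mu> i / \<sigma>\<^sup>2) * y i)" for y
      by (simp add: sum_distrib_left mult.assoc)
    have "(L y)\<^sup>2 = ennreal (exp (- ?S / \<sigma>\<^sup>2)) * ennreal (exp (\<Sum>i\<in>I. (2 * \<mu> i / \<sigma>\<^sup>2) * (y i - 0)))" for y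
      unfolding lin
      by (simp add: L_def ennreal_power exp_of_nat_mult[symmetric] ennreal_mult'[symmetric]
          mult_exp_exp sum_subtractf sum_divide_distrib[symmetric] right_diff_distrib)
    then have "(\<integral>\<^sup>+ y. (L y)\<^sup>2 \<partial>?Q) = ennreal (exp (- ?S / \<sigma>\<^sup>2)) *
        (\<integral>\<^sup>+ y. ennreal (exp (\<Sum>i\<in>I. (2 * \<mu> i / \<sigma>\<^sup>2) * (y i - 0))) \<partial>?Q)"
      by (simp only:) (rule nn_integral_cmult, measurable)
    also have "\<dots> = ennreal (exp (- ?S / \<sigma>\<^sup>2)) * ennreal (exp (\<sigma>\<^sup>2 * (\<Sum>i\<in>I. (2 * \<mu> i / \<sigma>\<^sup>2)\<^sup>2) / 2))"
      by (subst gauss_mgf[OF \<sigma> fin]) simp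
    also have "\<sigma>\<^sup>2 * (\<Sum>i\<in>I. (2 * \<mu> i / \<sigma>\<^sup>2)\<^sup>2) / 2 = 2 * ?S / \<sigma>\<^sup>2"
      using \<sigma> by (simp add: power_divide power_mult_distrib sum_divide_distrib[symmetric]
          sum_distrib_left[symmetric] power2_eq_square)
    finally show ?thesis
      by (simp add: ennreal_mult'[symmetric] mult_exp_exp diff_divide_distrib[symmetric])
  qed
  have "emeasure ?P A = (\<integral>\<^sup>+ y. L y * indicator A y \<partial>?Q)"
    unfolding gauss_eq_density[OF \<sigma> fin, of \<mu>] L_def[symmetric] using A' Lm
    by (subst emeasure_density) auto
  then have "(emeasure ?P A)\<^sup>2 \<le> (\<integral>\<^sup>+ y. (L y)\<^sup>2 \<partial>?Q) * (\<integral>\<^sup>+ y. (indicator A y)\<^sup>2 \<partial>?Q)"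
    using Lm A' by (simp only:) (rule Cauchy_Schwarz_nn_integral, auto)
  also have "(\<integral>\<^sup>+ y. (indicator A y)\<^sup>2 \<partial>?Q) = emeasure ?Q A"
  proof -
    have "(indicator A y :: ennreal)\<^sup>2 = indicator A y" for y by (simp add: indicator_def)
    then show ?thesis using A' by simp
  qed
  finally have "ennreal ((measure ?P A)\<^sup>2) \<le> ennreal (exp (?S / \<sigma>\<^sup>2) * measure ?Q A)"
    by (simp add: L2 P.emeasure_eq_measure Q.emeasure_eq_measure ennreal_power ennreal_mult'[symmetric])
  then show ?thesis by (simp add: ennreal_le_iff)
qed

subsection \<open>Sparse vectors and the restricted eigenvalue\<close>

lemma vnorm_nonneg [simp]: "0 \<le> vnorm v"
  by (simp add: vnorm_def L2_set_nonneg)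

lemma vnorm_power2: "(vnorm v)\<^sup>2 = (\<Sum>i<dim_vec v. (v $ i)\<^sup>2)"
  by (simp add: vnorm_def L2_set_def sum_nonneg)

lemma vnorm_zero [simp]: "vnorm (0\<^sub>v d) = 0"
  by (simp add: vnorm_def L2_set_def)

lemma vnorm_eq_0_iff: "v \<in> carrier_vec d \<Longrightarrow> vnorm v = 0 \<longleftrightarrow> v = 0\<^sub>v d"
  by (auto simp: vnorm_def L2_set_eq_0_iff)

lemma vnorm_smult: "vnorm (a \<cdot>\<^sub>v v) = \<bar>a\<bar> * vnorm v"
proof -
  have "(vnorm (a \<cdot>\<^sub>v v))\<^sup>2 = (\<bar>a\<bar> * vnorm v)\<^sup>2"
    by (simp add: vnorm_power2 power_mult_distrib sum_distrib_left)
  then show ?thesis by (simp add: power2_eq_iff_nonneg)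
qed

lemma mult_mat_vec_nth:
  fixes X :: "real mat"
  assumes "X \<in> carrier_mat n d" "v \<in> carrier_vec d" "i < n"
  shows "(X *\<^sub>v v) $ i = (\<Sum>j<d. X $$ (i, j) * v $ j)"
  using assms by (auto simp: scalar_prod_def lessThan_atLeast0 intro!: sum.cong)

lemma vnorm_mult_mat_vec_power2:
  assumes "X \<in> carrier_mat n d" "v \<in> carrier_vec d"
  shows "(vnorm (X *\<^sub>v v))\<^sup>2 = (\<Sum>i<n. (\<Sum>j<d. X $$ (i, j) * v $ j)\<^sup>2)"
proof -
  have "(vnorm (X *\<^sub>v v))\<^sup>2 = (\<Sum>i<n. ((X *\<^sub>v v) $ i)\<^sup>2)"
    using assms(1) by (simp only: vnorm_power2 dim_mult_mat_vec carrier_matD)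
  also have "\<dots> = (\<Sum>i<n. (\<Sum>j<d. X $$ (i, j) * v $ j)\<^sup>2)"
    by (intro sum.cong refl) (simp only: mult_mat_vec_nth[OF assms] lessThan_iff)
  finally show ?thesis .
qed

lemma abs_nth_le_vnorm:
  assumes "i < dim_vec v" shows "\<bar>v $ i\<bar> \<le> vnorm v"
  using member_le_L2_set[of "{..<dim_vec v}" i "\<lambda>i. \<bar>v $ i\<bar>"] assms
  by (simp add: vnorm_def L2_set_def)

lemma vnorm_mult_le_op_norm:
  assumes A: "A \<in> carrier_mat n k" and v: "v \<in> carrier_vec k"
  shows "vnorm (A *\<^sub>v v) \<le> op_norm A * vnorm v"
proof (cases "v = 0\<^sub>v k")
  case True
  then have "(vnorm (A *\<^sub>v v))\<^sup>2 = 0" using A by (simp add: vnorm_mult_mat_vec_power2)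
  then show ?thesis using True by simp
next
  case False
  let ?S = "{v \<in> carrier_vec k. vnorm v \<le> 1}"
  \<comment> \<open>\<open>op_norm\<close> is a supremum of reals and dominates its members only if
    they are bounded above. A crude bound suffices: entries of vectors in the unit ball are at most
    1 in absolute value.\<close>
  define B where "B = (\<Sum>i<n. (\<Sum>j<k. \<bar>A $$ (i, j)\<bar>)\<^sup>2)"
  have bdd: "bdd_above ((\<lambda>v. vnorm (A *\<^sub>v v)) ` ?S)"
  proof (rule bdd_aboveI2)
    fix u assume u: "u \<in> ?S"
    then have u': "u \<in> carrier_vec k" by simp
    have "(vnorm (A *\<^sub>v u))\<^sup>2 \<le> B"
      unfolding B_def vnorm_mult_mat_vec_power2[OF A u']
    proof (intro sum_mono)
      fix i assume "i \<in> {..<n}"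
      have "\<bar>A $$ (i, j) * u $ j\<bar> \<le> \<bar>A $$ (i, j)\<bar>" if "j < k" for j
        using abs_nth_le_vnorm[of j u] that u by (auto simp: abs_mult intro!: mult_left_le)
      then have "\<bar>\<Sum>j<k. A $$ (i, j) * u $ j\<bar> \<le> (\<Sum>j<k. \<bar>A $$ (i, j)\<bar>)"
        by (intro order_trans[OF sum_abs] sum_mono) auto
      then show "(\<Sum>j<k. A $$ (i, j) * u $ j)\<^sup>2 \<le> (\<Sum>j<k. \<bar>A $$ (i, j)\<bar>)\<^sup>2"
        using abs_le_square_iff by fastforce
    qed
    then show "vnorm (A *\<^sub>v u) \<le> sqrt B" by (rule real_le_rsqrt)
  qed
  have pos: "0 < vnorm v" using False vnorm_eq_0_iff[OF v] vnorm_nonneg[of v] by linarith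
  have "(1 / vnorm v) \<cdot>\<^sub>v v \<in> ?S" using v pos by (simp add: vnorm_smult)
  from cSUP_upper[OF this bdd] have "vnorm (A *\<^sub>v ((1 / vnorm v) \<cdot>\<^sub>v v)) \<le> op_norm A"
    unfolding op_norm_def carrier_matD[OF A] .
  then show ?thesis
    using A v pos by (simp add: mult_mat_vec vnorm_smult field_simps)
qed

text \<open>Column \<open>k\<close> of a column submatrix is column \<open>pick T k\<close> of the
  matrix; the bijection turns sums over submatrix columns into sums over \<open>T\<close>.\<close>

lemma bij_betw_pick:
  assumes "finite T" shows "bij_betw (pick T) {..<card T} T"
proof (rule bij_betw_imageI)
  show "inj_on (pick T) {..<card T}"
    by (rule linorder_inj_onI') (metis lessThan_iff nat_neq_iff pick_mono_le)
  have "pick T ` {..<card T} \<subseteq> T" by (auto intro: pick_in_set_le)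
  moreover have "T \<subseteq> pick T ` {..<card T}"
  proof
    fix i assume i: "i \<in> T"
    have "card {a \<in> T. a < i} < card T" using assms i by (intro psubset_card_mono) auto
    then show "i \<in> pick T ` {..<card T}" using pick_card_in_set[OF i] by force
  qed
  ultimately show "pick T ` {..<card T} = T" by auto
qed

text \<open>Rewrites an operator norm bound as an inequality between sums over \<open>T\<close>, the
  form in which \<open>sparse_design\<close> assumes it.\<close>

lemma select_cols_sum_le:
  assumes X: "X \<in> carrier_mat n d" and T: "T \<subseteq> {..<d}" and K: "op_norm (select_cols X T) \<le> K"
  shows "(\<Sum>i<n. (\<Sum>j\<in>T. X $$ (i, j) * g j)\<^sup>2) \<le> K\<^sup>2 * (\<Sum>j\<in>T. (g j)\<^sup>2)"
proof -
  have fin: "finite T" using T finite_subset by blast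
  have T': "{j. j < d \<and> j \<in> T} = T" using T by auto
  let ?A = "select_cols X T" and ?v = "vec (card T) (\<lambda>k. g (pick T k))"
  have A: "?A \<in> carrier_mat n (card T)"
    by (intro carrier_matI) (simp_all add: select_cols_def dim_submatrix carrier_matD[OF X] T')
  have idx: "?A $$ (i, k) = X $$ (i, pick T k)" if "i < n" "k < card T" for i k
    unfolding select_cols_def using that
    by (subst submatrix_index) (simp_all add: pick_UNIV carrier_matD[OF X] T')
  have "(vnorm (?A *\<^sub>v ?v))\<^sup>2 = (\<Sum>i<n. (\<Sum>k<card T. X $$ (i, pick T k) * g (pick T k))\<^sup>2)"
    by (subst vnorm_mult_mat_vec_power2[OF A]) (auto simp: idx intro!: sum.cong)
  also have "\<dots> = (\<Sum>i<n. (\<Sum>j\<in>T. X $$ (i, j) * g j)\<^sup>2)"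
    by (intro sum.cong arg_cong[where f="\<lambda>x. x\<^sup>2"] refl
        sum.reindex_bij_betw[OF bij_betw_pick[OF fin], of "\<lambda>j. X $$ (i, j) * g j" for i])
  finally have 1: "(vnorm (?A *\<^sub>v ?v))\<^sup>2 = (\<Sum>i<n. (\<Sum>j\<in>T. X $$ (i, j) * g j)\<^sup>2)" .
  have 2: "(vnorm ?v)\<^sup>2 = (\<Sum>j\<in>T. (g j)\<^sup>2)"
    by (simp add: vnorm_power2 sum.reindex_bij_betw[OF bij_betw_pick[OF fin], of "\<lambda>j. (g j)\<^sup>2"])
  have "vnorm (?A *\<^sub>v ?v) \<le> K * vnorm ?v"
    using vnorm_mult_le_op_norm[OF A, of ?v] mult_right_mono[OF K vnorm_nonneg[of ?v]] by simp
  then have "(vnorm (?A *\<^sub>v ?v))\<^sup>2 \<le> (K * vnorm ?v)\<^sup>2" by (intro power_mono) auto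
  then show ?thesis by (simp add: 1 2 power_mult_distrib)
qed

text \<open>In a decreasing nonnegative list everything before a nonzero entry is nonzero too, which
  makes at least \<open>k + 1\<close> nonzero entries.\<close>

lemma nonzero_nth_less_length_filter:
  fixes L :: "real list"
  assumes "sorted (rev L)" "\<forall>x\<in>set L. 0 \<le> x" "k < length L" "L ! k \<noteq> 0"
  shows "k < length (filter (\<lambda>x. x \<noteq> 0) L)"
proof -
  have "L ! i \<noteq> 0" if "i \<le> k" for i
    using sorted_rev_nth_mono[OF assms(1) that assms(3)] assms by (metis nth_mem order.antisym)
  then have "{..k} \<subseteq> {i. i < length L \<and> L ! i \<noteq> 0}" using assms(3) by auto
  from card_mono[OF _ this] show ?thesis by (simp add: length_filter_conv_card)
qed

text \<open>Sorting preserves the multiset of absolute values, hence the number of nonzero entries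
  and the sum of squares; the zeros come last.\<close>

lemma sharp_facts:
  assumes v: "v \<in> carrier_vec d"
  shows sharp_eq_0: "j \<in> {1..d} \<Longrightarrow> vnorm0 v < j \<Longrightarrow> sharp v j = 0"
    and sum_sharp_power2: "(\<Sum>j=1..d. (sharp v j)\<^sup>2) = (vnorm v)\<^sup>2"
proof -
  define L where "L = rev (sort (map abs (list_of_vec v)))"
  have len: "length L = d" using v by (simp add: L_def)
  have ms: "mset L = mset (map abs (list_of_vec v))" by (simp add: L_def)
  have nonneg: "\<forall>x\<in>set L. 0 \<le> x" by (auto simp: L_def)
  have sh: "sharp v j = L ! (j - 1)" for j by (simp add: sharp_def L_def)
  have "length (filter (\<lambda>x. x \<noteq> 0) L) = size (filter_mset (\<lambda>x. x \<noteq> 0) (mset L))"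
    by (metis mset_filter size_mset)
  also have "\<dots> = length (filter (\<lambda>x. x \<noteq> 0) (map abs (list_of_vec v)))"
    by (metis ms mset_filter size_mset)
  also have "\<dots> = vnorm0 v"
    unfolding length_filter_conv_card vnorm0_def
    by (intro arg_cong[where f=card]) (auto simp: list_of_vec_index)
  finally have cnt: "length (filter (\<lambda>x. x \<noteq> 0) L) = vnorm0 v" .
  show "sharp v j = 0" if "j \<in> {1..d}" "vnorm0 v < j"
  proof (rule ccontr)
    assume "sharp v j \<noteq> 0"
    moreover have "sorted (rev L)" by (simp add: L_def)
    \<comment> \<open>Ranks start at 1 and list indices at 0, so rank \<open>j\<close> sits at index
      \<open>j - 1\<close>.\<close>
    ultimately have "j - 1 < vnorm0 v"
      using nonzero_nth_less_length_filter[of L "j - 1"] nonneg that len by (simp add: sh cnt)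
    then show False using that by simp
  qed
  have "(\<Sum>j=1..d. (sharp v j)\<^sup>2) = (\<Sum>k<d. (L ! k)\<^sup>2)"
    unfolding sh by (rule sum.reindex_bij_witness[of _ Suc "\<lambda>j. j - 1"]) auto
  also have "\<dots> = (\<Sum>x\<leftarrow>L. x\<^sup>2)"
    using sum_list_sum_nth[of "map (\<lambda>x. x\<^sup>2) L"] by (simp add: len lessThan_atLeast0)
  also have "\<dots> = (\<Sum>x\<leftarrow>map abs (list_of_vec v). x\<^sup>2)"
    by (metis ms mset_map sum_mset_sum_list)
  also have "\<dots> = (vnorm v)\<^sup>2"
    using v unfolding vnorm_power2
    by (simp add: sum_list_sum_nth lessThan_atLeast0 list_of_vec_index)
  finally show "(\<Sum>j=1..d. (sharp v j)\<^sup>2) = (vnorm v)\<^sup>2" .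
qed

section \<open>Weights and membership in the weighted cone\<close>

lemma wre_weight_power2:
  assumes "j \<in> {1..d}"
  shows "(wre_weight n d \<sigma> j)\<^sup>2 = 36 * \<sigma>\<^sup>2 * (ln (2 * real d / real j) / real n)"
    and "0 \<le> ln (2 * real d / real j) / real n"
proof -
  have "1 \<le> 2 * real d / real j" using assms by (simp add: field_simps)
  then show "0 \<le> ln (2 * real d / real j) / real n" by simp
  then show "(wre_weight n d \<sigma> j)\<^sup>2 = 36 * \<sigma>\<^sup>2 * (ln (2 * real d / real j) / real n)"
    by (simp add: wre_weight_def power_mult_distrib)
qed

lemma wre_weight_antimono:
  assumes "1 \<le> i" "i \<le> j" "j \<le> d"
  shows "(wre_weight n d \<sigma> j)\<^sup>2 \<le> (wre_weight n d \<sigma> i)\<^sup>2"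
proof -
  have "ln (2 * real d / real j) \<le> ln (2 * real d / real i)"
    using assms by (subst ln_le_cancel_iff) (auto simp: field_simps)
  then show ?thesis
    using assms by (auto simp: wre_weight_power2 intro!: mult_left_mono divide_right_mono)
qed

text \<open>The squared weights decrease, so those with index above \<open>s\<close>, shifted down
  by \<open>s\<close>, are dominated by the first \<open>s\<close>.\<close>

lemma sum_wre_weight_double:
  assumes "1 \<le> s" "s \<le> d" "m = min (2 * s) d"
  shows "(\<Sum>j=1..m. (wre_weight n d \<sigma> j)\<^sup>2) \<le> 2 * (\<Sum>j=1..s. (wre_weight n d \<sigma> j)\<^sup>2)"
proof -
  let ?w = "\<lambda>j. (wre_weight n d \<sigma> j)\<^sup>2"
  have "{1..m} = {1..s} \<union> {s+1..m}" using assms by auto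
  then have "sum ?w {1..m} = sum ?w {1..s} + sum ?w {s+1..m}"
    by (simp add: sum.union_disjoint)
  also have "sum ?w {s+1..m} = (\<Sum>j=1..m-s. ?w (j + s))"
    using assms by (intro sum.reindex_bij_witness[of _ "\<lambda>j. j + s" "\<lambda>j. j - s"]) auto
  also have "\<dots> \<le> (\<Sum>j=1..m-s. ?w j)"
    using assms by (intro sum_mono wre_weight_antimono) auto
  also have "\<dots> \<le> sum ?w {1..s}"
    using assms by (intro sum_mono2) auto
  finally show ?thesis by simp
qed

text \<open>By Cauchy-Schwarz the weighted sum is at most \<open>vnorm v\<close> times the root of
  the first \<open>2 * s\<close> squared weights, and doubling the range at most doubles their sum.
  The factor 2 obtained here is below \<open>1 + 3\<close>. In the application \<open>t\<close> is
  \<open>max s 2\<close>.\<close>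

lemma sparse_in_wre_cone:
  assumes v: "v \<in> carrier_vec d" and sp: "vnorm0 v \<le> 2 * s"
    and s: "1 \<le> s" "s \<le> t" "t \<le> d" and \<sigma>: "0 \<le> \<sigma>"
  shows "v \<in> wre_cone n d \<sigma> t 3"
proof -
  let ?w = "wre_weight n d \<sigma>" and ?m = "min (2 * s) d"
  \<comment> \<open>Ranks above \<open>2 * s\<close> hold zeros, and ranks above \<open>d\<close> do
    not exist.\<close>
  have "(\<Sum>j=1..d. ?w j * sharp v j) = (\<Sum>j=1..?m. ?w j * sharp v j)"
    using sp by (intro sum.mono_neutral_right) (auto simp: sharp_eq_0[OF v])
  also have "\<dots> \<le> (\<Sum>j=1..?m. \<bar>?w j\<bar> * \<bar>sharp v j\<bar>)"
    by (intro sum_mono) (metis abs_ge_self abs_mult)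
  also have "\<dots> \<le> L2_set ?w {1..?m} * L2_set (sharp v) {1..?m}"
    by (rule L2_set_mult_ineq)
  also have "\<dots> \<le> (2 * sqrt (\<Sum>j=1..t. (?w j)\<^sup>2)) * vnorm v"
  proof (intro mult_mono)
    have "(\<Sum>j=1..?m. (?w j)\<^sup>2) \<le> 2 * (\<Sum>j=1..s. (?w j)\<^sup>2)"
      using s by (intro sum_wre_weight_double) auto
    also have "\<dots> \<le> 4 * (\<Sum>j=1..t. (?w j)\<^sup>2)"
      using s sum_mono2[of "{1..t}" "{1..s}" "\<lambda>j. (?w j)\<^sup>2"] sum_nonneg[of "{1..t}" "\<lambda>j. (?w j)\<^sup>2"]
      by fastforce
    finally show "L2_set ?w {1..?m} \<le> 2 * sqrt (\<Sum>j=1..t. (?w j)\<^sup>2)"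
      unfolding L2_set_def by (metis real_sqrt_four real_sqrt_le_mono real_sqrt_mult)
    have "(\<Sum>j=1..?m. (sharp v j)\<^sup>2) \<le> (vnorm v)\<^sup>2"
      unfolding sum_sharp_power2[OF v, symmetric] by (intro sum_mono2) auto
    then show "L2_set (sharp v) {1..?m} \<le> vnorm v"
      unfolding L2_set_def by (intro real_le_lsqrt) auto
  qed (auto simp: L2_set_nonneg intro: sum_nonneg)
  also have "\<dots> \<le> (1 + 3) * vnorm v * sqrt (\<Sum>j=1..t. (?w j)\<^sup>2)"
    by (simp add: mult.commute mult_right_mono sum_nonneg mult_left_mono)
  finally show ?thesis using v by (simp add: wre_cone_def)
qed

text \<open>The infimum is at most the quotient at the given vector, since the quotients are bounded
  below by 0. Sparsity \<open>2 * s\<close> is what a difference of two \<open>s\<close>-sparse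
  vectors needs.\<close>

lemma wre_const_sparse_lower:
  assumes X: "X \<in> carrier_mat n d" and n: "0 < n"
    and v: "v \<in> carrier_vec d" "vnorm0 v \<le> 2 * s"
    and s: "1 \<le> s" "s \<le> t" "t \<le> d" and \<sigma>: "0 \<le> \<sigma>" and c: "c \<le> wre_const X \<sigma> t 3"
  shows "c * sqrt (real n) * vnorm v \<le> vnorm (X *\<^sub>v v)"
proof (cases "v = 0\<^sub>v d")
  case True
  then show ?thesis by simp
next
  case False
  then have pos: "0 < vnorm v" using vnorm_eq_0_iff[OF v(1)] vnorm_nonneg[of v] by linarith
  have "wre_const X \<sigma> t 3 \<le> vnorm (X *\<^sub>v v) / (sqrt (real n) * vnorm v)"
    unfolding wre_const_def carrier_matD[OF X]
    using sparse_in_wre_cone[OF v s \<sigma>, of n] False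
    by (intro cINF_lower) (auto intro!: bdd_belowI2[where m=0])
  with c have "c \<le> vnorm (X *\<^sub>v v) / (sqrt (real n) * vnorm v)" by simp
  then show ?thesis using pos n by (simp add: field_simps)
qed

subsection \<open>Minimax quantiles over sparse vectors\<close>

text \<open>An estimator violating the bound has, at each parameter and law, an admissible level
  strictly below \<open>b\<close>. The lower bounds refute such a family of levels.\<close>

lemma minimax_quantile_ge:
  assumes "\<And>est r. est \<in> measurable S (pm_borel \<Theta> \<rho>) \<Longrightarrow>
      (\<And>\<theta> P. \<theta> \<in> \<Theta> \<Longrightarrow> P \<in> \<P> \<theta> \<Longrightarrow>
         0 \<le> r \<theta> P \<and> r \<theta> P < b \<and> 1 - \<delta> \<le> measure P {x \<in> space P. L (est x) \<theta> \<le> r \<theta> P}) \<Longrightarrow> False"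
  shows "ennreal b \<le> minimax_quantile \<delta> S \<Theta> \<rho> \<P> L"
  unfolding minimax_quantile_def
proof (rule INF_greatest, rule ccontr)
  fix est assume est: "est \<in> measurable S (pm_borel \<Theta> \<rho>)"
  let ?R = "\<lambda>\<theta> P. {r::real. 0 \<le> r \<and> measure P {x \<in> space P. L (est x) \<theta> \<le> r} \<ge> 1 - \<delta>}"
  assume "\<not> ennreal b \<le> (SUP \<theta>\<in>\<Theta>. SUP P\<in>\<P> \<theta>. INF r\<in>?R \<theta> P. ennreal r)"
  then have less: "(SUP \<theta>\<in>\<Theta>. SUP P\<in>\<P> \<theta>. INF r\<in>?R \<theta> P. ennreal r) < ennreal b" by simp
  have "\<exists>r. r \<in> ?R \<theta> P \<and> r < b" if "\<theta> \<in> \<Theta>" "P \<in> \<P> \<theta>" for \<theta> P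
  proof -
    have "(INF r\<in>?R \<theta> P. ennreal r) \<le> (SUP \<theta>\<in>\<Theta>. SUP P\<in>\<P> \<theta>. INF r\<in>?R \<theta> P. ennreal r)"
      using that by (intro SUP_upper2[of \<theta>] SUP_upper2[of P]) auto
    also note less
    \<comment> \<open>An empty set of admissible levels would have infimum infinity, which is not
      below \<open>b\<close>.\<close>
    finally obtain r where "r \<in> ?R \<theta> P" "ennreal r < ennreal b" unfolding INF_less_iff by blast
    then show ?thesis by (auto simp: ennreal_less_iff)
  qed
  then have "(SOME r. r \<in> ?R \<theta> P \<and> r < b) \<in> ?R \<theta> P \<and> (SOME r. r \<in> ?R \<theta> P \<and> r < b) < b"
    if "\<theta> \<in> \<Theta>" "P \<in> \<P> \<theta>" for \<theta> P
    using someI_ex[of "\<lambda>r. r \<in> ?R \<theta> P \<and> r < b"] that by blast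
  then show False
    by (intro assms[OF est, of "\<lambda>\<theta> P. SOME r. r \<in> ?R \<theta> P \<and> r < b"]) simp
qed

text \<open>A preimage under a map with countably many values is a countable union of fibres, so
  measurable fibres suffice.\<close>

lemma pm_borel_facts:
  shows space_pm_borel: "space (pm_borel \<Theta> \<rho>) = \<Theta>"
    and measurable_pm_borel_countable:
      "\<lbrakk>\<And>y. y \<in> space S \<Longrightarrow> est y \<in> Q; Q \<subseteq> \<Theta>; countable Q;
        \<And>q. q \<in> Q \<Longrightarrow> {y \<in> space S. est y = q} \<in> sets S\<rbrakk>
      \<Longrightarrow> est \<in> measurable S (pm_borel \<Theta> \<rho>)"
proof -
  let ?O = "{U. U \<subseteq> \<Theta> \<and> (\<forall>x\<in>U. \<exists>e>0. \<forall>y\<in>\<Theta>. \<rho> x y < e \<longrightarrow> y \<in> U)}"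
  have O: "?O \<subseteq> Pow \<Theta>" by auto
  show "space (pm_borel \<Theta> \<rho>) = \<Theta>" unfolding pm_borel_def by (rule space_measure_of[OF O])
  assume est: "\<And>y. y \<in> space S \<Longrightarrow> est y \<in> Q" and Q: "Q \<subseteq> \<Theta>" "countable Q"
    and m: "\<And>q. q \<in> Q \<Longrightarrow> {y \<in> space S. est y = q} \<in> sets S"
  show "est \<in> measurable S (pm_borel \<Theta> \<rho>)"
    unfolding pm_borel_def
  proof (rule measurable_measure_of[OF O])
    show "est \<in> space S \<rightarrow> \<Theta>" using est Q by auto
    fix U
    have "est -` U \<inter> space S = (\<Union>q\<in>Q \<inter> U. {y \<in> space S. est y = q})" using est by auto
    also have "\<dots> \<in> sets S" using m Q by (intro sets.countable_UN'') auto
    finally show "est -` U \<inter> space S \<in> sets S" .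
  qed
qed

lemma vnorm0_zero [simp]: "vnorm0 (0\<^sub>v d) = 0"
  by (simp add: vnorm0_def cong: conj_cong)

lemma vnorm0_minus_le:
  assumes "u \<in> carrier_vec d" "v \<in> carrier_vec d"
  shows "vnorm0 (u - v) \<le> vnorm0 u + vnorm0 v"
proof -
  have "{i. i < d \<and> (u - v) $ i \<noteq> 0} \<subseteq> {i. i < d \<and> u $ i \<noteq> 0} \<union> {i. i < d \<and> v $ i \<noteq> 0}"
    using assms by auto
  from card_mono[OF _ this] have "card {i. i < d \<and> (u - v) $ i \<noteq> 0}
      \<le> card ({i. i < d \<and> u $ i \<noteq> 0} \<union> {i. i < d \<and> v $ i \<noteq> 0})" by simp
  also have "\<dots> \<le> card {i. i < d \<and> u $ i \<noteq> 0} + card {i. i < d \<and> v $ i \<noteq> 0}"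
    by (rule card_Un_le)
  finally show ?thesis using assms by (simp add: vnorm0_def)
qed

lemma normal_iso_eq_gauss:
  assumes "X \<in> carrier_mat n d"
  shows "normal_iso (X *\<^sub>v \<theta>) \<sigma> = gauss {..<n} (\<lambda>i. (X *\<^sub>v \<theta>) $ i) \<sigma>"
  using assms by (simp add: normal_iso_def)

section \<open>Hamming balls over an alphabet of \<open>m\<close> letters\<close>

definition hamming :: "nat \<Rightarrow> (nat \<Rightarrow> nat) \<Rightarrow> (nat \<Rightarrow> nat) \<Rightarrow> nat" where
  "hamming p f g = card {i. i < p \<and> f i \<noteq> g i}"

text \<open>The generating function of the Hamming distance, \<open>(1 + (m - 1) q)^p\<close>, is evaluated at
  \<open>q = 1 / m\<close>.\<close>

lemma card_hamming_ball:
  assumes m: "1 \<le> m" and f: "f \<in> PiE {..<p} (\<lambda>_. {..<m})"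
  shows "real (card {g \<in> PiE {..<p} (\<lambda>_. {..<m}). 2 * hamming p f g \<le> p}) \<le> (2 * sqrt (real m)) ^ p"
proof -
  let ?F = "PiE {..<p} (\<lambda>_. {..<m})" and ?q = "\<lambda>i k. if k = f i then 1 else 1 / real m"
  let ?B = "{g \<in> ?F. 2 * hamming p f g \<le> p}"
  have finF: "finite ?F" by (intro finite_PiE) auto
  have prod: "(\<Prod>i<p. ?q i (g i)) = (1 / real m) ^ hamming p f g" for g
  proof -
    have "(\<Prod>i<p. ?q i (g i)) = (\<Prod>i\<in>{i. i < p \<and> f i \<noteq> g i}. 1 / real m)"
      by (intro prod.mono_neutral_cong_right) auto
    then show ?thesis by (simp add: hamming_def)
  qed
  have "real (card ?B) * (1 / sqrt (real m)) ^ p = (\<Sum>g\<in>?B. (1 / sqrt (real m)) ^ p)" by simp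
  \<comment> \<open>Inside the ball the distance is at most \<open>p / 2\<close>, so each member has
    weight at least \<open>(1 / sqrt (real m)) ^ p\<close> in the generating function.\<close>
  also have "\<dots> \<le> (\<Sum>g\<in>?B. (1 / real m) ^ hamming p f g)"
  proof (rule sum_mono)
    fix g assume "g \<in> ?B"
    then have "(1 / sqrt (real m)) ^ p \<le> (1 / sqrt (real m)) ^ (2 * hamming p f g)"
      using m by (intro power_decreasing) auto
    then show "(1 / sqrt (real m)) ^ p \<le> (1 / real m) ^ hamming p f g"
      by (simp add: power_mult power_divide)
  qed
  also have "\<dots> \<le> (\<Sum>g\<in>?F. \<Prod>i<p. ?q i (g i))"
    unfolding prod using finF by (intro sum_mono2) auto
  also have "\<dots> = (\<Prod>i<p. \<Sum>k<m. ?q i k)"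
    by (rule prod_sum_PiE[symmetric]) auto
  also have "\<dots> \<le> (\<Prod>i<p. 2)"
  proof (intro prod_mono conjI)
    fix i assume i: "i \<in> {..<p}"
    then have "f i \<in> {..<m}" using f by auto
    then have "(\<Sum>k<m. ?q i k) = 1 + (\<Sum>k\<in>{..<m} - {f i}. ?q i k)"
      by (subst sum.remove[of _ "f i"]) auto
    also have "(\<Sum>k\<in>{..<m} - {f i}. ?q i k) = (\<Sum>k\<in>{..<m} - {f i}. 1 / real m)"
      by (intro sum.cong) auto
    also have "\<dots> = (real m - 1) / real m"
      using \<open>f i \<in> {..<m}\<close> m by (simp add: of_nat_diff)
    also have "1 + (real m - 1) / real m \<le> 2" using m by (simp add: field_simps)
    finally show "(\<Sum>k<m. ?q i k) \<le> 2" .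
  qed (auto intro: sum_nonneg)
  finally have "real (card ?B) * (1 / sqrt (real m)) ^ p \<le> 2 ^ p" by simp
  then show ?thesis using m by (simp add: power_mult_distrib power_divide field_simps)
qed

text \<open>The comparisons \<open>lower\<close> and \<open>upper\<close> are what both bounds use
  of the design. \<open>lower\<close> is applied to differences of two \<open>s\<close>-sparse
  vectors, hence \<open>2 * s\<close>; \<open>upper\<close> to single supports, hence at most
  \<open>s\<close> columns.\<close>

locale sparse_design =
  fixes n d s :: nat and X :: "real mat" and c K \<sigma> :: real
  assumes n: "0 < n" and s: "1 \<le> s" "s \<le> d" and X: "X \<in> carrier_mat n d"
    and c: "0 < c" and K: "0 < K" and \<sigma>: "0 < \<sigma>"
    and lower: "\<And>v. v \<in> carrier_vec d \<Longrightarrow> vnorm0 v \<le> 2 * s \<Longrightarrow>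
        c * sqrt (real n) * vnorm v \<le> vnorm (X *\<^sub>v v)"
    and upper: "\<And>T g. T \<subseteq> {..<d} \<Longrightarrow> card T \<le> s \<Longrightarrow>
        (\<Sum>i<n. (\<Sum>j\<in>T. X $$ (i, j) * g j)\<^sup>2) \<le> K\<^sup>2 * real n * (\<Sum>j\<in>T. (g j)\<^sup>2)"
begin

abbreviation law :: "real vec \<Rightarrow> (nat \<Rightarrow> real) measure" where
  "law \<theta> \<equiv> gauss {..<n} (\<lambda>i. (X *\<^sub>v \<theta>) $ i) \<sigma>"

abbreviation null_law :: "(nat \<Rightarrow> real) measure" where
  "null_law \<equiv> gauss {..<n} (\<lambda>_. 0) \<sigma>"

lemma sparse_regression_quantile_alt:
  "sparse_regression_quantile \<delta> X s \<sigma> = minimax_quantile \<delta> (PiM {..<n} (\<lambda>_. borel)) (sparse_vecs d s)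
     (\<lambda>\<theta> \<theta>'. vnorm (\<theta> - \<theta>')) (\<lambda>\<theta>. {law \<theta>}) (pred_loss X)"
  using X by (simp add: sparse_regression_quantile_def normal_iso_eq_gauss[OF X])

lemma pred_loss_alt: "pred_loss X u v = (vnorm (X *\<^sub>v (u - v)))\<^sup>2 / real n"
  using X by (simp add: pred_loss_def)

lemma lower_power2:
  assumes "v \<in> carrier_vec d" "vnorm0 v \<le> 2 * s"
  shows "c\<^sup>2 * real n * (vnorm v)\<^sup>2 \<le> (vnorm (X *\<^sub>v v))\<^sup>2"
  using power_mono[OF lower[OF assms], of 2] c n by (simp add: power_mult_distrib)

text \<open>Triangle inequality in squared form: an estimate with loss below \<open>b\<close> at two
  parameters forces their predictions to be close.\<close>

lemma pred_loss_separation: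
  assumes "u \<in> carrier_vec d" "v \<in> carrier_vec d" "w \<in> carrier_vec d"
    and "pred_loss X u v \<le> r" "r < b" "pred_loss X u w \<le> r'" "r' < b"
  shows "(vnorm (X *\<^sub>v (v - w)))\<^sup>2 < 4 * real n * b"
proof -
  have D: "(vnorm (X *\<^sub>v (y - z)))\<^sup>2 = (\<Sum>i<n. ((X *\<^sub>v y) $ i - (X *\<^sub>v z) $ i)\<^sup>2)"
    if "y \<in> carrier_vec d" "z \<in> carrier_vec d" for y z
  proof -
    have "X *\<^sub>v (y - z) = X *\<^sub>v y - X *\<^sub>v z"
      using that X by (simp add: mult_minus_distrib_mat_vec)
    then show ?thesis using X by (simp add: vnorm_power2)
  qed
  have "(vnorm (X *\<^sub>v (v - w)))\<^sup>2
      \<le> (\<Sum>i<n. 2 * ((X *\<^sub>v u) $ i - (X *\<^sub>v v) $ i)\<^sup>2 + 2 * ((X *\<^sub>v u) $ i - (X *\<^sub>v w) $ i)\<^sup>2)"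
    unfolding D[OF assms(2,3)]
  proof (rule sum_mono)
    fix i
    \<comment> \<open>The right side minus the left side is the square of
      \<open>2 * f - a - e\<close>.\<close>
    have "(a - e)\<^sup>2 \<le> 2 * (f - a)\<^sup>2 + 2 * (f - e)\<^sup>2" for a e f :: real
      using zero_le_power2[of "2 * f - a - e"] by (simp add: power2_eq_square algebra_simps)
    then show "((X *\<^sub>v v) $ i - (X *\<^sub>v w) $ i)\<^sup>2
      \<le> 2 * ((X *\<^sub>v u) $ i - (X *\<^sub>v v) $ i)\<^sup>2 + 2 * ((X *\<^sub>v u) $ i - (X *\<^sub>v w) $ i)\<^sup>2" .
  qed
  also have "\<dots> = 2 * (real n * pred_loss X u v) + 2 * (real n * pred_loss X u w)"
    using n by (simp add: pred_loss_alt D[OF assms(1,2)] D[OF assms(1,3)] sum.distrib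
        sum_distrib_left[symmetric])
  finally have "(vnorm (X *\<^sub>v (v - w)))\<^sup>2
      \<le> 2 * (real n * pred_loss X u v) + 2 * (real n * pred_loss X u w)" .
  moreover have "real n * pred_loss X u v < real n * b" "real n * pred_loss X u w < real n * b"
    using n assms(4-7) by simp_all
  ultimately show ?thesis by linarith
qed

text \<open>The events \<open>A \<theta>\<close> are measurable for free: \<^const>\<open>measure\<close> is 0 on non-measurable
  sets, whereas \<open>1 - \<delta> > 0\<close>.\<close>

lemma sparse_regression_quantile_ge:
  assumes \<delta>: "\<delta> < 1"
    and A: "\<And>A. (\<And>\<theta>. \<theta> \<in> sparse_vecs d s \<Longrightarrow> A \<theta> \<in> sets (PiM {..<n} (\<lambda>_. borel)))
      \<Longrightarrow> (\<And>\<theta>. \<theta> \<in> sparse_vecs d s \<Longrightarrow> 1 - \<delta> \<le> measure (law \<theta>) (A \<theta>))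
      \<Longrightarrow> (\<And>y \<theta> \<theta>'. \<theta> \<in> sparse_vecs d s \<Longrightarrow> \<theta>' \<in> sparse_vecs d s \<Longrightarrow> y \<in> A \<theta> \<Longrightarrow> y \<in> A \<theta>' \<Longrightarrow>
             (vnorm (X *\<^sub>v (\<theta> - \<theta>')))\<^sup>2 < 4 * real n * b)
      \<Longrightarrow> False"
  shows "ennreal b \<le> sparse_regression_quantile \<delta> X s \<sigma>"
  unfolding sparse_regression_quantile_alt
proof (rule minimax_quantile_ge)
  fix est :: "(nat \<Rightarrow> real) \<Rightarrow> real vec" and r
  assume est: "est \<in> measurable (PiM {..<n} (\<lambda>_. borel)) (pm_borel (sparse_vecs d s) (\<lambda>\<theta> \<theta>'. vnorm (\<theta> - \<theta>')))"
    and r: "\<And>\<theta> P. \<theta> \<in> sparse_vecs d s \<Longrightarrow> P \<in> {law \<theta>} \<Longrightarrow>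
         0 \<le> r \<theta> P \<and> r \<theta> P < b \<and> 1 - \<delta> \<le> measure P {x \<in> space P. pred_loss X (est x) \<theta> \<le> r \<theta> P}"
  define A where "A \<theta> = {x \<in> space (law \<theta>). pred_loss X (est x) \<theta> \<le> r \<theta> (law \<theta>)}" for \<theta>
  have m: "1 - \<delta> \<le> measure (law \<theta>) (A \<theta>)" if "\<theta> \<in> sparse_vecs d s" for \<theta>
    using r[OF that] by (simp add: A_def)
  have meas: "A \<theta> \<in> sets (PiM {..<n} (\<lambda>_. borel))" if "\<theta> \<in> sparse_vecs d s" for \<theta>
  proof (rule ccontr)
    assume "A \<theta> \<notin> sets (PiM {..<n} (\<lambda>_. borel))"
    then have "measure (law \<theta>) (A \<theta>) = 0" by (intro measure_notin_sets) (simp add: sets_gauss)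
    with m[OF that] \<delta> show False by simp
  qed
  show False
  proof (rule A[of A])
    fix y \<theta> \<theta>' assume \<theta>: "\<theta> \<in> sparse_vecs d s" "\<theta>' \<in> sparse_vecs d s" and y: "y \<in> A \<theta>" "y \<in> A \<theta>'"
    have "y \<in> space (PiM {..<n} (\<lambda>_. borel))" using y by (simp add: A_def space_gauss)
    then have "est y \<in> sparse_vecs d s" using measurable_space[OF est] by (simp add: space_pm_borel)
    then show "(vnorm (X *\<^sub>v (\<theta> - \<theta>')))\<^sup>2 < 4 * real n * b"
      using \<theta> y r[OF \<theta>(1)] r[OF \<theta>(2)] unfolding sparse_vecs_def A_def
      by (intro pred_loss_separation[of "est y" \<theta> \<theta>' "r \<theta> (law \<theta>)" b "r \<theta>' (law \<theta>')"]) auto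
  qed (use m meas in auto)
qed

section \<open>Comparison with the null law and the confidence term\<close>

lemma law_le_null_law:
  assumes "A \<in> sets (PiM {..<n} (\<lambda>_. borel))" and "0 \<le> q" "q \<le> measure (law \<theta>) A"
  shows "q\<^sup>2 \<le> exp ((vnorm (X *\<^sub>v \<theta>))\<^sup>2 / \<sigma>\<^sup>2) * measure null_law A"
proof -
  have "q\<^sup>2 \<le> (measure (law \<theta>) A)\<^sup>2" using assms by (intro power_mono) auto
  also have "\<dots> \<le> exp ((\<Sum>i<n. ((X *\<^sub>v \<theta>) $ i)\<^sup>2) / \<sigma>\<^sup>2) * measure null_law A"
    using assms(1) by (intro gauss_change_of_mean \<sigma>) auto
  also have "(\<Sum>i<n. ((X *\<^sub>v \<theta>) $ i)\<^sup>2) = (vnorm (X *\<^sub>v \<theta>))\<^sup>2"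
    using X by (simp add: vnorm_power2)
  finally show ?thesis .
qed

lemma law_zero: "law (0\<^sub>v d) = null_law"
proof (intro PiM_cong refl)
  fix i assume "i \<in> {..<n}"
  then have "(X *\<^sub>v 0\<^sub>v d) $ i = 0" by (subst mult_mat_vec_nth[OF X]) (auto intro: sum.neutral)
  then show "normal_measure ((X *\<^sub>v 0\<^sub>v d) $ i) \<sigma> = normal_measure 0 \<sigma>" by (simp only:)
qed

text \<open>The hypotheses 0 and a multiple of a unit vector sit exactly at the separation that
  makes their events disjoint. The event of \<open>\<theta>\<close> then has null probability at
  most \<open>\<delta>\<close>, while the change of mean demands
  \<open>(1 - \<delta>)\<^sup>2 \<le> \<delta> powr (3 / 4)\<close>, which fails for
  \<open>\<delta> \<le> 1 / 4\<close>.\<close>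

lemma quantile_ge_confidence:
  assumes \<delta>: "0 < \<delta>" "\<delta> \<le> 1/4"
  shows "ennreal (\<sigma>\<^sup>2 * ln (1 / \<delta>) / (16 * real n)) \<le> sparse_regression_quantile \<delta> X s \<sigma>"
proof (rule sparse_regression_quantile_ge)
  fix A :: "real vec \<Rightarrow> (nat \<Rightarrow> real) set"
  assume meas: "\<And>\<theta>. \<theta> \<in> sparse_vecs d s \<Longrightarrow> A \<theta> \<in> sets (PiM {..<n} (\<lambda>_. borel))"
    and prob: "\<And>\<theta>. \<theta> \<in> sparse_vecs d s \<Longrightarrow> 1 - \<delta> \<le> measure (law \<theta>) (A \<theta>)"
    and sep: "\<And>y \<theta> \<theta>'. \<theta> \<in> sparse_vecs d s \<Longrightarrow> \<theta>' \<in> sparse_vecs d s \<Longrightarrow> y \<in> A \<theta> \<Longrightarrow> y \<in> A \<theta>' \<Longrightarrow>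
             (vnorm (X *\<^sub>v (\<theta> - \<theta>')))\<^sup>2 < 4 * real n * (\<sigma>\<^sup>2 * ln (1 / \<delta>) / (16 * real n))"
  define e :: "real vec" where "e = unit_vec d 0"
  have e: "e \<in> carrier_vec d" by (simp add: e_def)
  have "{i. i < d \<and> e $ i \<noteq> 0} = {0}" using s by (auto simp: e_def unit_vec_def split: if_splits)
  then have e0: "vnorm0 e = 1" using e by (simp add: vnorm0_def)
  have "e \<noteq> 0\<^sub>v d"
    using e0 by auto
  then have "0 < vnorm e" using vnorm_eq_0_iff[OF e] vnorm_nonneg[of e] by linarith
  then have "0 < c * sqrt (real n) * vnorm e" using c n by simp
  also have "\<dots> \<le> vnorm (X *\<^sub>v e)" using e0 s by (intro lower e) simp
  finally have w: "0 < vnorm (X *\<^sub>v e)" .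
  \<comment> \<open>\<open>R\<close> is \<open>4 * real n * b\<close> for the claimed bound
    \<open>b\<close>. As \<open>X *\<^sub>v e\<close> is nonzero, \<open>e\<close> can be scaled to
    have squared prediction norm \<open>R\<close>.\<close>
  define R where "R = \<sigma>\<^sup>2 * ln (1 / \<delta>) / 4"
  have R: "0 \<le> R" using \<delta> by (simp add: R_def)
  define \<theta> where "\<theta> = (sqrt R / vnorm (X *\<^sub>v e)) \<cdot>\<^sub>v e"
  have \<theta>: "\<theta> \<in> carrier_vec d" using e by (simp add: \<theta>_def)
  have "(vnorm (X *\<^sub>v \<theta>))\<^sup>2 = R"
    using w R X e unfolding \<theta>_def by (simp add: mult_mat_vec vnorm_smult)
  then have norm: "(vnorm (X *\<^sub>v (\<theta> - 0\<^sub>v d)))\<^sup>2 = R" "(vnorm (X *\<^sub>v \<theta>))\<^sup>2 = R" using \<theta> by simp_all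
  have "vnorm0 \<theta> \<le> vnorm0 e" using e
    by (auto simp: \<theta>_def vnorm0_def intro!: card_mono)
  then have in\<Theta>: "\<theta> \<in> sparse_vecs d s" "0\<^sub>v d \<in> sparse_vecs d s"
    using \<theta> e0 s by (auto simp: sparse_vecs_def)
  interpret N: prob_space null_law by (rule prob_space_gauss[OF \<sigma>])
  \<comment> \<open>A common point would make the squared distance strictly less than
    \<open>R\<close>, but it equals \<open>R\<close>.\<close>
  have "A \<theta> \<inter> A (0\<^sub>v d) = {}"
    using sep[OF in\<Theta>] norm n by (auto simp: R_def)
  then have "measure null_law (A \<theta>) + measure null_law (A (0\<^sub>v d)) \<le> 1"
    using meas[OF in\<Theta>(1)] meas[OF in\<Theta>(2)]
    by (subst N.finite_measure_Union[symmetric]) (auto simp: sets_gauss)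
  with prob[OF in\<Theta>(2)] have le: "measure null_law (A \<theta>) \<le> \<delta>" by (simp add: law_zero)
  have "(1 - \<delta>)\<^sup>2 \<le> exp (R / \<sigma>\<^sup>2) * measure null_law (A \<theta>)"
    using law_le_null_law[OF meas[OF in\<Theta>(1)] _ prob[OF in\<Theta>(1)]] \<delta> norm by simp
  also have "\<dots> \<le> exp (R / \<sigma>\<^sup>2) * \<delta>" using le by simp
  also have "R / \<sigma>\<^sup>2 = ln (1 / \<delta>) / 4" using \<sigma> by (simp add: R_def)
  finally have main: "(1 - \<delta>)\<^sup>2 \<le> exp (ln (1 / \<delta>) / 4) * \<delta>" .
  \<comment> \<open>Fourth powers remove the root: \<open>(9 / 16) ^ 4\<close> is about 0.1, whereas
    \<open>(1 / 4) ^ 3\<close> is about 0.016.\<close>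
  have "(3 / 4)\<^sup>2 \<le> (1 - \<delta>)\<^sup>2" using \<delta> by (intro power_mono) auto
  with main have "((3 / 4)\<^sup>2) ^ 4 \<le> (exp (ln (1 / \<delta>) / 4) * \<delta>) ^ 4" by (intro power_mono) auto
  also have "\<dots> = \<delta> ^ 3"
  proof -
    have "exp (ln (1 / \<delta>) / 4) ^ 4 = 1 / \<delta>" using \<delta> by (simp add: exp_of_nat_mult[symmetric])
    then show ?thesis
      using \<delta> by (simp only: power_mult_distrib) (simp add: power3_eq_cube power4_eq_xxxx)
  qed
  also have "\<dots> \<le> (1 / 4) ^ 3" using \<delta> by (intro power_mono) auto
  finally show False by (simp add: power2_eq_square power3_eq_cube power4_eq_xxxx)
qed (use \<delta> in simp)

end

subsection \<open>Lower bound\<close>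

text \<open>Code words as sparse vectors: coordinate \<open>i * m + x\<close> stands for letter
  \<open>x\<close> in block \<open>i\<close>, and \<open>f\<close> picks one letter in each of
  \<open>p\<close> blocks.\<close>

definition block_vec :: "nat \<Rightarrow> nat \<Rightarrow> nat \<Rightarrow> real \<Rightarrow> (nat \<Rightarrow> nat) \<Rightarrow> real vec" where
  "block_vec d p m a f = vec d (\<lambda>k. if k \<in> (\<lambda>i. i * m + f i) ` {..<p} then a else 0)"

lemma block_index_eq_iff:
  fixes m :: nat
  assumes "x < m" "y < m"
  shows "i * m + x = j * m + y \<longleftrightarrow> i = j \<and> x = y"
proof
  assume eq: "i * m + x = j * m + y"
  have "(i * m + x) div m = i" "(j * m + y) div m = j" using assms by auto
  with eq show "i = j \<and> x = y" by auto
qed simp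

context
  fixes d p m :: nat
  assumes pm: "p * m \<le> d" and m: "1 \<le> m"
begin

lemma block_index_less:
  assumes "i < p" "x < m" shows "i * m + x < d"
proof -
  have "i * m + x < Suc i * m" using assms by simp
  also have "\<dots> \<le> p * m" using assms by (intro mult_le_mono1) simp
  finally show ?thesis using pm by simp
qed

lemma block_vec_nth:
  assumes f: "f \<in> PiE {..<p} (\<lambda>_. {..<m})" and g: "g \<in> PiE {..<p} (\<lambda>_. {..<m})" and i: "i < p"
  shows "block_vec d p m a g $ (i * m + f i) = (if f i = g i then a else 0)"
proof -
  have fi: "f i < m" using f i by auto
  have "i * m + f i \<in> (\<lambda>i. i * m + g i) ` {..<p} \<longleftrightarrow> f i = g i"
  proof
    assume "i * m + f i \<in> (\<lambda>i. i * m + g i) ` {..<p}"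
    then obtain j where j: "j < p" "i * m + f i = j * m + g j" by auto
    then have "g j < m" using g by auto
    from block_index_eq_iff[OF fi this, of i j] j(2) have "i = j \<and> f i = g j" by simp
    then show "f i = g i" by auto
  qed (use i in auto)
  then show ?thesis using block_index_less[OF i fi] by (simp add: block_vec_def)
qed

lemma block_support:
  assumes f: "f \<in> PiE {..<p} (\<lambda>_. {..<m})"
  shows "(\<lambda>i. i * m + f i) ` {..<p} \<subseteq> {..<d}" "card ((\<lambda>i. i * m + f i) ` {..<p}) \<le> p"
    "vnorm0 (block_vec d p m a f) \<le> p"
proof -
  let ?T = "(\<lambda>i. i * m + f i) ` {..<p}"
  show "?T \<subseteq> {..<d}" using f block_index_less by (auto simp: PiE_iff)
  show card: "card ?T \<le> p" using card_image_le[of "{..<p}" "\<lambda>i. i * m + f i"] by simp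
  have "card {i. i < d \<and> block_vec d p m a f $ i \<noteq> 0} \<le> card ?T"
    by (intro card_mono) (auto simp: block_vec_def split: if_splits)
  with card show "vnorm0 (block_vec d p m a f) \<le> p" by (simp add: vnorm0_def block_vec_def)
qed

text \<open>In each block where the words differ, the position chosen by \<open>f\<close> holds
  \<open>a\<close> in one vector and 0 in the other; these positions alone give the bound.\<close>

lemma block_vec_distance:
  assumes f: "f \<in> PiE {..<p} (\<lambda>_. {..<m})" and g: "g \<in> PiE {..<p} (\<lambda>_. {..<m})"
  shows "a\<^sup>2 * real (hamming p f g) \<le> (vnorm (block_vec d p m a f - block_vec d p m a g))\<^sup>2"
proof -
  let ?u = "block_vec d p m a f" and ?v = "block_vec d p m a g"
  let ?H = "{i. i < p \<and> f i \<noteq> g i}"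
  have car: "?u \<in> carrier_vec d" "?v \<in> carrier_vec d" by (auto simp: block_vec_def)
  have inj: "inj_on (\<lambda>i. i * m + f i) ?H"
    using f by (auto simp: inj_on_def PiE_iff block_index_eq_iff)
  have less: "i * m + f i < d" if "i \<in> ?H" for i
    using that f by (intro block_index_less) auto
  have "a\<^sup>2 * real (hamming p f g) = (\<Sum>i\<in>?H. ((?u - ?v) $ (i * m + f i))\<^sup>2)"
  proof -
    have "((?u - ?v) $ (i * m + f i))\<^sup>2 = a\<^sup>2" if "i \<in> ?H" for i
      using that car less[OF that] block_vec_nth[OF f f, of i a] block_vec_nth[OF f g, of i a] by simp
    then show ?thesis by (simp add: hamming_def)
  qed
  also have "\<dots> = (\<Sum>k\<in>(\<lambda>i. i * m + f i) ` ?H. ((?u - ?v) $ k)\<^sup>2)"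
    by (simp add: sum.reindex[OF inj])
  also have "\<dots> \<le> (\<Sum>k<d. ((?u - ?v) $ k)\<^sup>2)"
    using less by (intro sum_mono2) auto
  also have "\<dots> = (vnorm (?u - ?v))\<^sup>2" using car by (simp add: vnorm_power2)
  finally show ?thesis .
qed

end

context sparse_design
begin

lemma vnorm_block_vec_le:
  assumes pm: "p * m \<le> d" "1 \<le> m" "p \<le> s" and f: "f \<in> PiE {..<p} (\<lambda>_. {..<m})"
  shows "(vnorm (X *\<^sub>v block_vec d p m a f))\<^sup>2 \<le> K\<^sup>2 * real n * (real p * a\<^sup>2)"
proof -
  let ?T = "(\<lambda>i. i * m + f i) ` {..<p}" and ?u = "block_vec d p m a f"
  note T = block_support[OF pm(1,2) f]
  have "(vnorm (X *\<^sub>v ?u))\<^sup>2 = (\<Sum>i<n. (\<Sum>j<d. X $$ (i, j) * ?u $ j)\<^sup>2)"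
    by (intro vnorm_mult_mat_vec_power2 X) (simp add: block_vec_def)
  also have "\<dots> = (\<Sum>i<n. (\<Sum>j\<in>?T. X $$ (i, j) * a)\<^sup>2)"
    using T(1) by (intro sum.cong refl arg_cong[where f="\<lambda>x. x\<^sup>2"] sum.mono_neutral_cong_right)
      (auto simp: block_vec_def)
  also have "\<dots> \<le> K\<^sup>2 * real n * (\<Sum>j\<in>?T. a\<^sup>2)"
    using T pm by (intro upper) auto
  also have "\<dots> \<le> K\<^sup>2 * real n * (real p * a\<^sup>2)"
    using T(2) by (auto intro!: mult_left_mono mult_right_mono)
  finally show ?thesis .
qed

text \<open>Each of the \<open>m ^ p\<close> code words has an event of null probability at least
  \<open>(9 / 16) / E\<close>, and no sample lies in more than \<open>M\<close> of these events.
  Hence \<open>m ^ p * (9 / 16) \<le> E * M\<close>, which is false for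
  \<open>m \<ge> 64\<close>.\<close>

lemma quantile_ge_blocks:
  assumes \<delta>: "0 < \<delta>" "\<delta> \<le> 1/4" and pm: "1 \<le> p" "p \<le> s" "64 \<le> m" "p * m \<le> d"
  shows "ennreal (c\<^sup>2 * \<sigma>\<^sup>2 * (real p * ln (real m)) / (96 * K\<^sup>2 * real n))
     \<le> sparse_regression_quantile \<delta> X s \<sigma>"
proof (rule sparse_regression_quantile_ge)
  let ?b = "c\<^sup>2 * \<sigma>\<^sup>2 * (real p * ln (real m)) / (96 * K\<^sup>2 * real n)"
  fix A :: "real vec \<Rightarrow> (nat \<Rightarrow> real) set"
  assume meas: "\<And>\<theta>. \<theta> \<in> sparse_vecs d s \<Longrightarrow> A \<theta> \<in> sets (PiM {..<n} (\<lambda>_. borel))"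
    and prob: "\<And>\<theta>. \<theta> \<in> sparse_vecs d s \<Longrightarrow> 1 - \<delta> \<le> measure (law \<theta>) (A \<theta>)"
    and sep: "\<And>y \<theta> \<theta>'. \<theta> \<in> sparse_vecs d s \<Longrightarrow> \<theta>' \<in> sparse_vecs d s \<Longrightarrow> y \<in> A \<theta> \<Longrightarrow> y \<in> A \<theta>' \<Longrightarrow>
             (vnorm (X *\<^sub>v (\<theta> - \<theta>')))\<^sup>2 < 4 * real n * ?b"
  let ?F = "PiE {..<p} (\<lambda>_. {..<m})"
  have m1: "1 \<le> m" using pm by simp
  \<comment> \<open>This entry size keeps the squared prediction norm divided by
    \<open>\<sigma>\<^sup>2\<close> at most \<open>p * ln m / 12\<close>, so the change of mean
    costs only the factor \<open>E\<close>, the power \<open>p / 12\<close> of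
    \<open>m\<close>.\<close>
  define a where "a = sqrt (\<sigma>\<^sup>2 * ln (real m) / (12 * K\<^sup>2 * real n))"
  have a2: "a\<^sup>2 = \<sigma>\<^sup>2 * ln (real m) / (12 * K\<^sup>2 * real n)" using m1 by (simp add: a_def)
  have a_pos: "0 < a\<^sup>2" unfolding a2 using pm n K \<sigma> by (intro divide_pos_pos mult_pos_pos ln_gt_zero) auto
  have b: "?b = c\<^sup>2 * a\<^sup>2 * real p / 8" by (simp add: a2 ac_simps)
  define \<theta> where "\<theta> = block_vec d p m a"
  have car: "\<theta> f \<in> carrier_vec d" for f by (simp add: \<theta>_def block_vec_def)
  have sp: "vnorm0 (\<theta> f) \<le> s" if "f \<in> ?F" for f
    using block_support(3)[OF pm(4) m1 that] pm(2) unfolding \<theta>_def by (rule order_trans)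
  have in\<Theta>: "\<theta> f \<in> sparse_vecs d s" if "f \<in> ?F" for f
    using sp[OF that] car by (simp add: sparse_vecs_def)
  interpret N: prob_space null_law by (rule prob_space_gauss[OF \<sigma>])
  define B where "B f = A (\<theta> f)" for f
  have B_meas: "B f \<in> sets null_law" if "f \<in> ?F" for f
    using meas[OF in\<Theta>[OF that]] by (simp add: B_def sets_gauss)
  \<comment> \<open>For this bound the separation threshold is
    \<open>c\<^sup>2 * real n * (a\<^sup>2 * real p / 2)\<close>, so by the lower comparison a
    common sample point leaves fewer than \<open>p / 2\<close> differing blocks.\<close>
  have B_close: "2 * hamming p f g \<le> p" if "f \<in> ?F" "g \<in> ?F" "y \<in> B f" "y \<in> B g" for f g y
  proof -
    have "vnorm0 (\<theta> f - \<theta> g) \<le> 2 * s"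
      using vnorm0_minus_le[OF car car, of f g] sp[OF that(1)] sp[OF that(2)] by simp
    then have "c\<^sup>2 * real n * (vnorm (\<theta> f - \<theta> g))\<^sup>2 \<le> (vnorm (X *\<^sub>v (\<theta> f - \<theta> g)))\<^sup>2"
      using car by (intro lower_power2) auto
    also have "\<dots> < 4 * real n * (c\<^sup>2 * a\<^sup>2 * real p / 8)"
      using sep[OF in\<Theta>[OF that(1)] in\<Theta>[OF that(2)]] that unfolding B_def b by blast
    also have "\<dots> = c\<^sup>2 * real n * (a\<^sup>2 * real p / 2)" by simp
    finally have "(vnorm (\<theta> f - \<theta> g))\<^sup>2 < a\<^sup>2 * real p / 2"
      using c n by (simp add: mult_less_cancel_left_pos)
    moreover have "a\<^sup>2 * real (hamming p f g) \<le> (vnorm (\<theta> f - \<theta> g))\<^sup>2"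
      using block_vec_distance[OF pm(4) m1 that(1,2), of a] by (simp add: \<theta>_def)
    ultimately have "a\<^sup>2 * real (hamming p f g) < a\<^sup>2 * (real p / 2)" by linarith
    then have "real (hamming p f g) < real p / 2" using a_pos by (simp add: mult_less_cancel_left_pos)
    then show ?thesis by linarith
  qed
  have finF: "finite ?F" by (intro finite_PiE) auto
  define M where "M = (2 * sqrt (real m)) ^ p"
  \<comment> \<open>All words whose events contain \<open>y\<close> lie in a Hamming ball around any
    one of them.\<close>
  have overlap: "(\<Sum>f\<in>?F. indicator (B f) y) \<le> M" for y
  proof (cases "\<exists>f0\<in>?F. y \<in> B f0")
    case True
    then obtain f0 where f0: "f0 \<in> ?F" "y \<in> B f0" by blast
    have "(\<Sum>f\<in>?F. indicator (B f) y) = real (card {f \<in> ?F. y \<in> B f})"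
      using finF by (simp add: indicator_def sum.If_cases Int_def)
    also have "\<dots> \<le> real (card {g \<in> ?F. 2 * hamming p f0 g \<le> p})"
      using finF B_close[OF f0(1) _ f0(2)] by (intro of_nat_mono card_mono) auto
    also have "\<dots> \<le> M" unfolding M_def by (rule card_hamming_ball[OF m1 f0(1)])
    finally show ?thesis .
  next
    case False
    then have "(\<Sum>f\<in>?F. indicator (B f) y) = (0::real)" by (intro sum.neutral) auto
    then show ?thesis by (simp add: M_def)
  qed
  \<comment> \<open>Double counting: the null probabilities sum to the mean number of events
    containing the sample.\<close>
  have "(\<Sum>f\<in>?F. measure null_law (B f)) = (\<Sum>f\<in>?F. \<integral>y. indicator (B f) y \<partial>null_law)"
    using B_meas by (intro sum.cong refl) (simp add: sets.Int_space_eq2)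
  also have "\<dots> = (\<integral>y. (\<Sum>f\<in>?F. indicator (B f) y) \<partial>null_law)"
    using B_meas by (intro Bochner_Integration.integral_sum[symmetric])
      (auto simp: N.emeasure_eq_measure)
  also have "\<dots> \<le> (\<integral>y. M \<partial>null_law)"
    using B_meas by (intro integral_mono overlap Bochner_Integration.integrable_sum)
      (auto simp: N.emeasure_eq_measure)
  also have "\<dots> = M" by (simp add: N.prob_space)
  finally have total: "(\<Sum>f\<in>?F. measure null_law (B f)) \<le> M" .
  define E where "E = exp (real p * ln (real m) / 12)"
  have each: "(3 / 4)\<^sup>2 \<le> E * measure null_law (B f)" if f: "f \<in> ?F" for f
  proof -
    have "(3 / 4)\<^sup>2 \<le> exp ((vnorm (X *\<^sub>v \<theta> f))\<^sup>2 / \<sigma>\<^sup>2) * measure null_law (B f)"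
      unfolding B_def using meas[OF in\<Theta>[OF f]] prob[OF in\<Theta>[OF f]] \<delta>
      by (intro law_le_null_law) auto
    also have "\<dots> \<le> E * measure null_law (B f)"
    proof (intro mult_right_mono)
      have "(vnorm (X *\<^sub>v \<theta> f))\<^sup>2 / \<sigma>\<^sup>2 \<le> (K\<^sup>2 * real n * (real p * a\<^sup>2)) / \<sigma>\<^sup>2"
        unfolding \<theta>_def by (intro divide_right_mono vnorm_block_vec_le[OF pm(4) m1 pm(2) f]) simp
      also have "\<dots> = real p * ln (real m) / 12" using \<sigma> K n by (simp add: a2)
      finally show "exp ((vnorm (X *\<^sub>v \<theta> f))\<^sup>2 / \<sigma>\<^sup>2) \<le> E" by (simp add: E_def)
    qed simp
    finally show ?thesis .
  qed
  have "real m ^ p * (9 / 16) = (\<Sum>f\<in>?F. (3 / 4)\<^sup>2)" by (simp add: card_PiE power2_eq_square)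
  also have "\<dots> \<le> (\<Sum>f\<in>?F. E * measure null_law (B f))" by (intro sum_mono each)
  also have "\<dots> \<le> E * M"
    unfolding sum_distrib_left[symmetric] by (intro mult_left_mono total) (simp add: E_def)
  finally have "real m ^ p * (9 / 16) \<le> E * M" .
  then have le: "ln (real m ^ p * (9 / 16)) \<le> ln (E * M)"
    using m1 by (intro iffD2[OF ln_le_cancel_iff]) (auto simp: E_def M_def)
  have "real p * ln (real m) + ln (9 / 16) \<le> real p * ln (real m) / 12 + real p * (ln 2 + ln (real m) / 2)"
  proof -
    have "ln (real m ^ p * (9 / 16)) = real p * ln (real m) + ln (9 / 16)"
      using m1 by (subst ln_mult_pos) (auto simp: ln_realpow)
    moreover have "ln (E * M) = real p * ln (real m) / 12 + real p * (ln 2 + ln (real m) / 2)"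
      using m1 unfolding E_def M_def
      by (subst ln_mult_pos) (auto simp: ln_realpow ln_mult_pos ln_sqrt algebra_simps)
    ultimately show ?thesis using le by (simp only:)
  qed
  \<comment> \<open>As \<open>64 = 2 ^ 6\<close>, the factor \<open>2 ^ p\<close> in
    \<open>M\<close> is at most the power \<open>p / 6\<close> of \<open>m\<close>. The exponents
    1/12, 1/2 and 1/6 sum to 3/4, and the power \<open>p / 4\<close> of \<open>m\<close> left over
    exceeds 16/9.\<close>
  moreover have "6 * ln 2 \<le> ln (real m)"
  proof -
    have "6 * ln 2 = ln (2 ^ 6 :: real)" by (subst ln_realpow) auto
    also have "\<dots> \<le> ln (real m)" using pm by (subst ln_le_cancel_iff) auto
    finally show ?thesis .
  qed
  then have "real p * (6 * ln 2) \<le> real p * ln (real m)" by (intro mult_left_mono) auto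
  moreover have "1 * ln 2 \<le> real p * ln (2::real)" using pm by (intro mult_right_mono) auto
  moreover have "- ln 2 < ln (9 / 16 :: real)"
  proof -
    have "- ln 2 = ln (1 / 2 :: real)" by (simp add: ln_div)
    also have "\<dots> < ln (9 / 16 :: real)" by (subst ln_less_cancel_iff) auto
    finally show ?thesis .
  qed
  moreover have "0 < ln (2::real)" by simp
  ultimately show False by (simp add: algebra_simps)
qed (use \<delta> in simp)

text \<open>Follows from \<open>ln x \<le> x - 1\<close> at \<open>x = d / s\<close>. It shows that
  a large complexity term forces a large \<open>d\<close>.\<close>

lemma complexity_le:
  "real s * ln (exp 1 * real d / real s) \<le> real d" "0 \<le> ln (exp 1 * real d / real s)"
proof -
  have "ln (exp 1 * real d / real s) = 1 + ln (real d / real s)"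
    using s by (simp add: ln_mult_pos ln_div)
  moreover have "ln (real d / real s) \<le> real d / real s - 1"
    using s by (intro ln_le_minus_one) auto
  ultimately have "real s * ln (exp 1 * real d / real s) \<le> real s * (real d / real s)"
    by (intro mult_left_mono) auto
  then show "real s * ln (exp 1 * real d / real s) \<le> real d" using s by simp
  have "0 \<le> ln (real d / real s)" using s by simp
  with \<open>ln (exp 1 * real d / real s) = 1 + ln (real d / real s)\<close>
  show "0 \<le> ln (exp 1 * real d / real s)" by simp
qed

text \<open>If \<open>s \<le> d div 64\<close>, then \<open>s\<close> blocks of length about
  \<open>d / s\<close> have \<open>ln m\<close> comparable to \<open>ln (e d / s)\<close>. Otherwise
  the complexity is at most \<open>d\<close>, and \<open>d div 64\<close> blocks of length at least
  64 already give order \<open>d\<close>. The constant is \<open>12288 = 96 * 128\<close>.\<close>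

lemma quantile_ge_complexity:
  assumes \<delta>: "0 < \<delta>" "\<delta> \<le> 1/4" and d: "64 \<le> d"
  shows "ennreal (c\<^sup>2 * \<sigma>\<^sup>2 * (real s * ln (exp 1 * real d / real s)) / (12288 * K\<^sup>2 * real n))
     \<le> sparse_regression_quantile \<delta> X s \<sigma>"
proof -
  let ?h = "real s * ln (exp 1 * real d / real s)"
  define p where "p = min s (d div 64)"
  define m where "m = d div p"
  have d1: "1 \<le> d div 64" using d by (simp add: Suc_le_eq div_greater_zero_iff)
  have p: "1 \<le> p" "p \<le> s" "p \<le> d div 64" using s d1 by (auto simp: p_def)
  have "p * 64 \<le> d" using p(3) by (meson le_trans mult_le_mono1 div_times_less_eq_dividend)
  then have m: "64 \<le> m" using p(1) by (simp add: m_def less_eq_div_iff_mult_less_eq mult.commute)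
  have pm: "p * m \<le> d" by (simp add: m_def)
  have h: "?h / 128 \<le> real p * ln (real m)"
  proof (cases "s \<le> d div 64")
    case True
    then have ps: "p = s" by (simp add: p_def)
    have "d < s * (m + 1)" using dividend_less_times_div[of s d] s unfolding m_def ps by simp
    then have "real d < real (s * (m + 1))" by (simp only: of_nat_less_iff)
    then have "real d < real s * (real m + 1)" by (simp add: distrib_left)
    then have "real d / real s \<le> real m + 1" using s by (simp add: field_simps)
    also have "\<dots> \<le> 2 * real m" using m by simp
    finally have ds: "real d / real s \<le> 2 * real m" .
    \<comment> \<open>Since \<open>e \<le> 3\<close> and \<open>6 \<le> m\<close>, the argument of
      the logarithm is at most the square of \<open>m\<close>.\<close>
    have "exp 1 * (real d / real s) \<le> 3 * (2 * real m)"
      using ds exp_le by (intro mult_mono) auto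
    also have "\<dots> \<le> real m * real m" using m by (simp add: mult_right_mono)
    finally have "ln (exp 1 * real d / real s) \<le> ln (real m * real m)"
      using s m by (subst ln_le_cancel_iff) auto
    also have "\<dots> = 2 * ln (real m)" using m by (simp add: ln_mult_pos)
    finally have "?h \<le> real s * (2 * ln (real m))" by (intro mult_left_mono) auto
    moreover have "0 \<le> real s * ln (real m)" using m by simp
    ultimately show ?thesis unfolding ps by simp
  next
    case False
    then have pd: "p = d div 64" by (simp add: p_def)
    \<comment> \<open>From \<open>d < 64 * (p + 1)\<close> and \<open>1 \<le> p\<close>.\<close>
    have "d < 128 * p" using d1 div_mult_mod_eq[of d 64] mod_less_divisor[of 64 d] unfolding pd by linarith
    then have "real d \<le> 128 * real p" by linarith
    moreover have "1 \<le> ln (real m)"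
    proof -
      have "exp 1 \<le> real m" using exp_le m by linarith
      then show ?thesis using m by (simp add: ln_ge_iff)
    qed
    then have "real p * 1 \<le> real p * ln (real m)" by (intro mult_left_mono) auto
    ultimately show ?thesis using complexity_le by simp
  qed
  have "c\<^sup>2 * \<sigma>\<^sup>2 * ?h / (12288 * K\<^sup>2 * real n) = c\<^sup>2 * \<sigma>\<^sup>2 * (?h / 128) / (96 * K\<^sup>2 * real n)" by simp
  also have "\<dots> \<le> c\<^sup>2 * \<sigma>\<^sup>2 * (real p * ln (real m)) / (96 * K\<^sup>2 * real n)"
    by (intro divide_right_mono mult_left_mono h) auto
  finally show ?thesis
    using quantile_ge_blocks[OF \<delta> p(1,2) m pm] by (meson ennreal_leI order_trans)
qed

text \<open>The dominant term decides which bound is used. Beyond the threshold 64 the complexity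
  exceeds 64, because \<open>ln (1 / \<delta>) \<ge> 1\<close>, and then \<open>d \<ge> 64\<close>
  as the blocks require. The constants are \<open>2080 = 16 * 130\<close> and
  \<open>24576 = 2 * 12288\<close>.\<close>

lemma quantile_lower_bound:
  assumes \<delta>: "0 < \<delta>" "\<delta> \<le> 1/4"
    and k: "0 \<le> k" "k \<le> 1 / 2080" "k \<le> c\<^sup>2 / (24576 * K\<^sup>2)"
  shows "ennreal (k * (\<sigma>\<^sup>2 * ((real s * ln (exp 1 * real d / real s) + ln (1 / \<delta>)) / real n)))
     \<le> sparse_regression_quantile \<delta> X s \<sigma>"
proof -
  let ?h = "real s * ln (exp 1 * real d / real s)" and ?Q = "sparse_regression_quantile \<delta> X s \<sigma>"
  have "ln 4 \<le> ln (1 / \<delta>)" using \<delta> by (subst ln_le_cancel_iff) (auto simp: field_simps)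
  moreover have "1 \<le> ln (4::real)" using exp_le by (simp add: ln_ge_iff)
  ultimately have L: "1 \<le> ln (1 / \<delta>)" by simp
  have h0: "0 \<le> ?h" using complexity_le(2) by simp
  have pos: "0 \<le> \<sigma>\<^sup>2 / real n" by simp
  show ?thesis
  proof (cases "?h \<le> 64 * ln (1 / \<delta>)")
    case True
    have "k * (?h + ln (1 / \<delta>)) \<le> 1 / 2080 * (130 * ln (1 / \<delta>))"
      using True h0 k L by (intro mult_mono) auto
    then have "k * (?h + ln (1 / \<delta>)) \<le> ln (1 / \<delta>) / 16" by simp
    from mult_left_mono[OF this pos]
    have "k * (\<sigma>\<^sup>2 * ((?h + ln (1 / \<delta>)) / real n)) \<le> \<sigma>\<^sup>2 * ln (1 / \<delta>) / (16 * real n)"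
      by (simp add: mult.commute mult.left_commute)
    then show ?thesis using quantile_ge_confidence[OF \<delta>] by (meson ennreal_leI order_trans)
  next
    case False
    then have d: "64 \<le> d" using complexity_le(1) L by linarith
    have "k * (?h + ln (1 / \<delta>)) \<le> c\<^sup>2 / (24576 * K\<^sup>2) * (2 * ?h)"
      using False h0 k L by (intro mult_mono) auto
    then have "k * (?h + ln (1 / \<delta>)) \<le> c\<^sup>2 * ?h / (12288 * K\<^sup>2)"
      by (simp add: mult.commute mult.left_commute)
    from mult_left_mono[OF this pos]
    have "k * (\<sigma>\<^sup>2 * ((?h + ln (1 / \<delta>)) / real n)) \<le> c\<^sup>2 * \<sigma>\<^sup>2 * ?h / (12288 * K\<^sup>2 * real n)"
      by (simp add: mult.commute mult.left_commute)
    then show ?thesis using quantile_ge_complexity[OF \<delta> d] by (meson ennreal_leI order_trans)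
  qed
qed

end

subsection \<open>Upper bound\<close>

text \<open>Give each subset \<open>T\<close> the weight \<open>x ^ card T\<close> with
  \<open>x = s / d \<le> 1\<close>. Small subsets weigh at least \<open>x ^ s\<close>, and all
  subsets together weigh \<open>(1 + x) ^ d \<le> exp s\<close>.\<close>

lemma card_small_subsets_le:
  assumes s: "1 \<le> s" "s \<le> d"
  shows "real (card {T. T \<subseteq> {..<d} \<and> card T \<le> s}) \<le> (exp 1 * real d / real s) ^ s"
proof -
  let ?\<T> = "{T. T \<subseteq> {..<d} \<and> card T \<le> s}" and ?x = "real s / real d"
  have x: "0 < ?x" "?x \<le> 1" using s by auto
  have "real (card ?\<T>) * ?x ^ s = (\<Sum>T\<in>?\<T>. ?x ^ s)" by simp
  also have "\<dots> \<le> (\<Sum>T\<in>?\<T>. ?x ^ card T)"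
    using x by (intro sum_mono power_decreasing) auto
  also have "\<dots> \<le> (\<Sum>T\<in>Pow {..<d}. ?x ^ card T)"
    by (intro sum_mono2) auto
  also have "\<dots> = (?x + 1) ^ d"
    using prod_add[of "{..<d}" "\<lambda>_. ?x" "\<lambda>_. 1"] by simp
  also have "\<dots> \<le> exp (real s)"
    using exp_ge_one_plus_x_over_n_power_n[of d "real s"] s by (simp add: add.commute)
  finally have "real (card ?\<T>) * ?x ^ s \<le> exp 1 ^ s" by (simp add: exp_of_nat_mult[symmetric])
  then show ?thesis using s by (simp add: power_divide power_mult_distrib field_simps)
qed

text \<open>The approximant of 0 is 0, so rounding the entries of a vector in this way creates no
  new nonzero entries.\<close>

lemma tendsto_floor_quotient:
  fixes x :: real
  shows "(\<lambda>N. of_int \<lfloor>real (Suc N) * x\<rfloor> / real (Suc N)) \<longlonglongrightarrow> x"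
proof (rule tendsto_sandwich[of "\<lambda>N. x - inverse (real (Suc N))" _ _ "\<lambda>_. x"])
  have le: "real (Suc N) * x - 1 \<le> of_int \<lfloor>real (Suc N) * x\<rfloor>"
    "of_int \<lfloor>real (Suc N) * x\<rfloor> \<le> real (Suc N) * x" for N
    by linarith+
  have "x - inverse (real (Suc N)) \<le> of_int \<lfloor>real (Suc N) * x\<rfloor> / real (Suc N)" for N
    using divide_right_mono[OF le(1), of "real (Suc N)" N] by (simp add: diff_divide_distrib inverse_eq_divide)
  then show "\<forall>\<^sub>F N in sequentially. x - inverse (real (Suc N)) \<le> of_int \<lfloor>real (Suc N) * x\<rfloor> / real (Suc N)"
    by simp
  have "of_int \<lfloor>real (Suc N) * x\<rfloor> / real (Suc N) \<le> x" for N
    using divide_right_mono[OF le(2), of "real (Suc N)" N] by simp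
  then show "\<forall>\<^sub>F N in sequentially. of_int \<lfloor>real (Suc N) * x\<rfloor> / real (Suc N) \<le> x" by simp
  show "(\<lambda>N. x - inverse (real (Suc N))) \<longlonglongrightarrow> x"
    using tendsto_diff[OF tendsto_const LIMSEQ_inverse_real_of_nat, of x] by simp
qed simp

lemma minimax_quantile_le:
  assumes "est \<in> measurable S (pm_borel \<Theta> \<rho>)" "0 \<le> b"
    and "\<And>\<theta> P. \<theta> \<in> \<Theta> \<Longrightarrow> P \<in> \<P> \<theta> \<Longrightarrow> 1 - \<delta> \<le> measure P {x \<in> space P. L (est x) \<theta> \<le> b}"
  shows "minimax_quantile \<delta> S \<Theta> \<rho> \<P> L \<le> ennreal b"
  unfolding minimax_quantile_def
  by (rule INF_lower2[OF assms(1)], intro SUP_least INF_lower) (use assms(2,3) in auto)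

context sparse_design
begin

section \<open>Approximate least squares over rational sparse vectors\<close>

definition rss :: "real vec \<Rightarrow> (nat \<Rightarrow> real) \<Rightarrow> real" where
  "rss \<theta> y = (\<Sum>i<n. (y i - (X *\<^sub>v \<theta>) $ i)\<^sup>2)"

lemma rss_measurable [measurable]: "rss \<theta> \<in> borel_measurable (PiM {..<n} (\<lambda>_. borel))"
  unfolding rss_def by measurable

definition rational_sparse_vecs :: "real vec set" where
  "rational_sparse_vecs = {v \<in> sparse_vecs d s. set\<^sub>v v \<subseteq> \<rat>}"

lemma countable_rational_sparse_vecs: "countable rational_sparse_vecs"
proof -
  have "rational_sparse_vecs \<subseteq> vec_of_list ` lists \<rat>"
  proof
    fix v assume "v \<in> rational_sparse_vecs"
    then have "list_of_vec v \<in> lists \<rat>" by (auto simp: rational_sparse_vecs_def list_all_iff set_list_of_vec)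
    then show "v \<in> vec_of_list ` lists \<rat>" by (metis image_eqI vec_list)
  qed
  then show ?thesis
    by (rule countable_subset) (intro countable_image countable_lists countable_rat)
qed

text \<open>The residual sum of squares is continuous in the parameter, and a sparse vector is a
  limit of rational vectors supported within its support.\<close>

lemma rss_rational_approx:
  assumes \<theta>: "\<theta> \<in> sparse_vecs d s" and bound: "\<And>q. q \<in> rational_sparse_vecs \<Longrightarrow> b \<le> rss q y"
  shows "b \<le> rss \<theta> y"
proof -
  have \<theta>c: "\<theta> \<in> carrier_vec d" using \<theta> by (simp add: sparse_vecs_def)
  define q where "q N = map_vec (\<lambda>x. of_int \<lfloor>real (Suc N) * x\<rfloor> / real (Suc N)) \<theta>" for N
  have qc: "q N \<in> carrier_vec d" for N using \<theta>c by (simp add: q_def)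
  have "vnorm0 (q N) \<le> vnorm0 \<theta>" for N
    unfolding vnorm0_def by (intro card_mono) (auto simp: q_def)
  then have "q N \<in> sparse_vecs d s" for N
    using \<theta> qc[of N] by (auto simp: sparse_vecs_def intro: order_trans)
  moreover have "set\<^sub>v (q N) \<subseteq> \<rat>" for N
    by (auto simp: vec_set_def q_def simp del: of_nat_Suc intro!: Rats_divide)
  ultimately have q: "q N \<in> rational_sparse_vecs" for N
    by (simp add: rational_sparse_vecs_def)
  have "(\<lambda>N. rss (q N) y) \<longlonglongrightarrow> rss \<theta> y"
    unfolding rss_def
  proof (intro tendsto_sum tendsto_power tendsto_diff tendsto_const)
    fix i assume i: "i \<in> {..<n}"
    have "(\<lambda>N. \<Sum>j<d. X $$ (i, j) * q N $ j) \<longlonglongrightarrow> (\<Sum>j<d. X $$ (i, j) * \<theta> $ j)"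
    proof (intro tendsto_sum tendsto_mult tendsto_const)
      fix j assume "j \<in> {..<d}"
      then have "q N $ j = of_int \<lfloor>real (Suc N) * \<theta> $ j\<rfloor> / real (Suc N)" for N
        using \<theta>c by (simp add: q_def)
      then show "(\<lambda>N. q N $ j) \<longlonglongrightarrow> \<theta> $ j" using tendsto_floor_quotient[of "\<theta> $ j"] by simp
    qed
    then show "(\<lambda>N. (X *\<^sub>v q N) $ i) \<longlonglongrightarrow> (X *\<^sub>v \<theta>) $ i"
      using i mult_mat_vec_nth[OF X qc, of i] mult_mat_vec_nth[OF X \<theta>c, of i] by simp
  qed
  then show ?thesis by (rule LIMSEQ_le_const) (use bound q in auto)
qed

text \<open>With the tolerance \<open>\<epsilon>\<close> the infimum over the countable set need not
  be attained, and taking the first good index of an enumeration makes the selection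
  measurable.\<close>

lemma near_least_squares_exists:
  assumes \<epsilon>: "0 < \<epsilon>"
  obtains e :: "nat \<Rightarrow> real vec" and idx :: "(nat \<Rightarrow> real) \<Rightarrow> nat"
  where "\<And>k. e k \<in> sparse_vecs d s" "idx \<in> measurable (PiM {..<n} (\<lambda>_. borel)) (count_space UNIV)"
    and "\<And>y \<theta>. \<theta> \<in> sparse_vecs d s \<Longrightarrow> rss (e (idx y)) y \<le> rss \<theta> y + \<epsilon>"
proof -
  let ?Q = rational_sparse_vecs
  define e where "e = from_nat_into ?Q"
  have "0\<^sub>v d \<in> ?Q" by (auto simp: rational_sparse_vecs_def sparse_vecs_def vec_set_def)
  then have ne: "?Q \<noteq> {}" by auto
  then have e: "e k \<in> ?Q" for k unfolding e_def by (rule from_nat_into)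
  have surj: "\<exists>k. e k = q" if "q \<in> ?Q" for q
    using from_nat_into_surj[OF countable_rational_sparse_vecs that] by (simp add: e_def)
  \<comment> \<open>The condition compares with every other candidate instead of with the infimum,
    so it consists of countably many comparisons of measurable functions.\<close>
  define idx where "idx y = (LEAST k. \<forall>l. rss (e k) y \<le> rss (e l) y + \<epsilon>)" for y
  have idx: "rss (e (idx y)) y \<le> rss (e l) y + \<epsilon>" for y l
  proof -
    let ?R = "range (\<lambda>k. rss (e k) y)"
    have "bdd_below ?R" by (intro bdd_belowI2[where m=0]) (simp add: rss_def sum_nonneg)
    then have low: "Inf ?R \<le> rss (e l) y" for l by (intro cINF_lower) auto
    obtain k where "rss (e k) y < Inf ?R + \<epsilon>"
      using cInf_lessD[of ?R "Inf ?R + \<epsilon>"] \<epsilon> by auto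
    with low have "\<forall>l. rss (e k) y \<le> rss (e l) y + \<epsilon>" by (smt (verit))
    then show ?thesis unfolding idx_def by (rule LeastI2) auto
  qed
  show ?thesis
  proof (rule that[of e idx])
    show "e k \<in> sparse_vecs d s" for k using e[of k] by (simp add: rational_sparse_vecs_def)
    show "idx \<in> measurable (PiM {..<n} (\<lambda>_. borel)) (count_space UNIV)"
    proof -
      have "Measurable.pred (PiM {..<n} (\<lambda>_. borel)) (\<lambda>y. rss (e k) y \<le> rss (e l) y + \<epsilon>)" for k l
        unfolding pred_def by (intro borel_measurable_le borel_measurable_add rss_measurable) simp
      then show ?thesis unfolding idx_def by measurable
    qed
    fix y \<theta> assume "\<theta> \<in> sparse_vecs d s"
    then have "rss (e (idx y)) y - \<epsilon> \<le> rss \<theta> y"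
      using idx[of y] by (rule_tac rss_rational_approx) (use surj in \<open>force simp: algebra_simps\<close>)+
    then show "rss (e (idx y)) y \<le> rss \<theta> y + \<epsilon>" by simp
  qed
qed

text \<open>The squared norm of the transposed submatrix of the columns in \<open>T\<close> applied
  to the noise \<open>y - X \<theta>\<close>.\<close>

definition score :: "real vec \<Rightarrow> nat set \<Rightarrow> (nat \<Rightarrow> real) \<Rightarrow> real" where
  "score \<theta> T y = (\<Sum>j\<in>T. (\<Sum>i<n. X $$ (i, j) * (y i - (X *\<^sub>v \<theta>) $ i))\<^sup>2)"

lemma score_measurable [measurable]: "score \<theta> T \<in> borel_measurable (PiM {..<n} (\<lambda>_. borel))"
  unfolding score_def by measurable

text \<open>Exponential Markov inequality at the scale where \<open>gauss_chaos_mgf\<close> applies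
  with \<open>B = K\<^sup>2 * real n\<close>.\<close>

lemma score_tail:
  assumes T: "T \<subseteq> {..<d}" "card T \<le> s"
  shows "measure (law \<theta>) {y \<in> space (law \<theta>). M < score \<theta> T y}
     \<le> exp (- M / (4 * \<sigma>\<^sup>2 * (K\<^sup>2 * real n))) * sqrt 2 ^ s"
proof -
  let ?b = "4 * \<sigma>\<^sup>2 * (K\<^sup>2 * real n)"
  have b: "0 < ?b" using \<sigma> K n by simp
  interpret P: prob_space "law \<theta>" by (rule prob_space_gauss[OF \<sigma>])
  have [measurable]: "score \<theta> T \<in> borel_measurable (law \<theta>)"
    using score_measurable by (simp add: measurable_gauss)
  have finT: "finite T" using T finite_subset by blast
  have "emeasure (law \<theta>) {y \<in> space (law \<theta>). M < score \<theta> T y}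
     = (\<integral>\<^sup>+ y. indicator {y \<in> space (law \<theta>). M < score \<theta> T y} y \<partial>law \<theta>)"
    by (subst nn_integral_indicator) auto
  also have "\<dots> \<le> (\<integral>\<^sup>+ y. ennreal (exp (- M / ?b)) * ennreal (exp (score \<theta> T y / ?b)) \<partial>law \<theta>)"
  proof (rule nn_integral_mono)
    fix y
    have "1 \<le> exp (- M / ?b) * exp (score \<theta> T y / ?b)" if "M < score \<theta> T y"
      using that b by (simp add: mult_exp_exp divide_right_mono)
    then show "indicator {y \<in> space (law \<theta>). M < score \<theta> T y} y
        \<le> ennreal (exp (- M / ?b)) * ennreal (exp (score \<theta> T y / ?b))"
      by (auto simp: indicator_def ennreal_mult'[symmetric])
  qed
  also have "\<dots> = ennreal (exp (- M / ?b)) * (\<integral>\<^sup>+ y. ennreal (exp (score \<theta> T y / ?b)) \<partial>law \<theta>)"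
    by (rule nn_integral_cmult) measurable
  also have "\<dots> \<le> ennreal (exp (- M / ?b)) * ennreal (sqrt 2 ^ card T)"
    unfolding score_def using finT K n upper[OF T]
    by (intro mult_left_mono gauss_chaos_mgf[OF \<sigma>]) auto
  also have "\<dots> \<le> ennreal (exp (- M / ?b) * sqrt 2 ^ s)"
    using T by (auto simp: ennreal_mult'[symmetric] intro!: ennreal_leI mult_left_mono power_increasing)
  finally show ?thesis by (simp add: P.emeasure_eq_measure)
qed

text \<open>In the union bound the first two summands cancel the number of supports and the factor
  \<open>sqrt 2 ^ s\<close>; the third leaves probability \<open>\<delta>\<close>.\<close>

definition score_bound :: "real \<Rightarrow> real" where
  "score_bound \<delta> = 4 * \<sigma>\<^sup>2 * (K\<^sup>2 * real n) *
     (real s * ln (exp 1 * real d / real s) + real s * ln (sqrt 2) + ln (1 / \<delta>))"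

lemma score_uniform_tail:
  assumes \<delta>: "0 < \<delta>"
  shows "1 - \<delta> \<le> measure (law \<theta>)
    {y \<in> space (law \<theta>). \<forall>T. T \<subseteq> {..<d} \<and> card T \<le> s \<longrightarrow> score \<theta> T y \<le> score_bound \<delta>}"
proof -
  let ?\<T> = "{T. T \<subseteq> {..<d} \<and> card T \<le> s}" and ?M = "score_bound \<delta>"
  let ?bad = "\<lambda>T. {y \<in> space (law \<theta>). ?M < score \<theta> T y}"
  interpret P: prob_space "law \<theta>" by (rule prob_space_gauss[OF \<sigma>])
  have [measurable]: "score \<theta> T \<in> borel_measurable (law \<theta>)" for T
    using score_measurable by (simp add: measurable_gauss)
  have fin: "finite ?\<T>" by (rule finite_subset[of _ "Pow {..<d}"]) auto
  have pos: "0 < exp 1 * real d / real s" using s by simp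
  have "measure (law \<theta>) (\<Union>T\<in>?\<T>. ?bad T) \<le> (\<Sum>T\<in>?\<T>. measure (law \<theta>) (?bad T))"
    using fin by (intro P.finite_measure_subadditive_finite) auto
  also have "\<dots> \<le> (\<Sum>T\<in>?\<T>. exp (- ?M / (4 * \<sigma>\<^sup>2 * (K\<^sup>2 * real n))) * sqrt 2 ^ s)"
    by (intro sum_mono score_tail) auto
  also have "\<dots> = real (card ?\<T>) * (exp (- ?M / (4 * \<sigma>\<^sup>2 * (K\<^sup>2 * real n))) * sqrt 2 ^ s)" by simp
  also have "\<dots> \<le> (exp 1 * real d / real s) ^ s * (exp (- ?M / (4 * \<sigma>\<^sup>2 * (K\<^sup>2 * real n))) * sqrt 2 ^ s)"
    by (intro mult_right_mono card_small_subsets_le s) auto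
  also have "- ?M / (4 * \<sigma>\<^sup>2 * (K\<^sup>2 * real n))
      = - (real s * ln (exp 1 * real d / real s)) - real s * ln (sqrt 2) - ln (1 / \<delta>)"
    using \<sigma> K n by (simp add: score_bound_def)
  also have "exp \<dots> = inverse ((exp 1 * real d / real s) ^ s) * inverse (sqrt 2 ^ s) * \<delta>"
  proof -
    have "exp (real s * ln x) = x ^ s" if "0 < x" for x :: real
      using that by (simp add: exp_of_nat_mult)
    then show ?thesis using pos \<delta> by (simp only: exp_diff exp_minus) (simp add: divide_inverse)
  qed
  also have "(exp 1 * real d / real s) ^ s * (inverse ((exp 1 * real d / real s) ^ s) * inverse (sqrt 2 ^ s) * \<delta> * sqrt 2 ^ s) = \<delta>"
  proof -
    have *: "a * (inverse a * inverse b * \<delta> * b) = \<delta>" if "a \<noteq> 0" "b \<noteq> 0" for a b :: real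
      using that by (simp add: field_simps)
    show ?thesis by (rule *) (use s in auto)
  qed
  finally have "measure (law \<theta>) (\<Union>T\<in>?\<T>. ?bad T) \<le> \<delta>" .
  then have "1 - \<delta> \<le> measure (law \<theta>) (space (law \<theta>) - (\<Union>T\<in>?\<T>. ?bad T))"
    using fin by (subst P.prob_compl) auto
  also have "space (law \<theta>) - (\<Union>T\<in>?\<T>. ?bad T)
    = {y \<in> space (law \<theta>). \<forall>T. T \<subseteq> {..<d} \<and> card T \<le> s \<longrightarrow> score \<theta> T y \<le> ?M}"
    by (auto simp: not_less)
  finally show ?thesis .
qed

text \<open>The basic inequality of least squares: the noise enters only through its inner product with
  \<open>X (u - \<theta>)\<close>, hence only through the scores of the supports of \<open>u\<close> and \<open>\<theta>\<close>.\<close>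

lemma least_squares_loss:
  assumes u: "u \<in> sparse_vecs d s" and \<theta>: "\<theta> \<in> sparse_vecs d s"
    and fit: "rss u y \<le> rss \<theta> y + \<epsilon>"
    and M: "\<And>T. T \<subseteq> {..<d} \<Longrightarrow> card T \<le> s \<Longrightarrow> score \<theta> T y \<le> M"
  shows "pred_loss X u \<theta> \<le> 8 * M / (c\<^sup>2 * (real n)\<^sup>2) + 2 * \<epsilon> / real n"
proof -
  have car: "u \<in> carrier_vec d" "\<theta> \<in> carrier_vec d" "u - \<theta> \<in> carrier_vec d"
    using u \<theta> by (auto simp: sparse_vecs_def)
  have sparse: "vnorm0 u \<le> s" "vnorm0 \<theta> \<le> s" using u \<theta> by (auto simp: sparse_vecs_def)
  have X_diff: "(X *\<^sub>v (u - \<theta>)) $ i = (X *\<^sub>v u) $ i - (X *\<^sub>v \<theta>) $ i" if "i < n" for i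
    using that car X by (simp add: mult_minus_distrib_mat_vec)
  define W where "W = vnorm (X *\<^sub>v (u - \<theta>))"
  define z where "z j = (\<Sum>i<n. X $$ (i, j) * (y i - (X *\<^sub>v \<theta>) $ i))" for j
  let ?supp = "\<lambda>v. {j. j < d \<and> v $ j \<noteq> (0::real)}"
  have W2: "W\<^sup>2 = (\<Sum>i<n. ((X *\<^sub>v u) $ i - (X *\<^sub>v \<theta>) $ i)\<^sup>2)"
  proof -
    have "W\<^sup>2 = (\<Sum>i<n. ((X *\<^sub>v (u - \<theta>)) $ i)\<^sup>2)" using X by (simp add: W_def vnorm_power2)
    then show ?thesis by (simp add: X_diff)
  qed
  have "rss u y = rss \<theta> y - 2 * (\<Sum>i<n. (y i - (X *\<^sub>v \<theta>) $ i) * (X *\<^sub>v (u - \<theta>)) $ i) + W\<^sup>2"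
    unfolding rss_def W2 sum_distrib_left sum_subtractf[symmetric] sum.distrib[symmetric]
    by (intro sum.cong refl) (simp add: X_diff power2_eq_square algebra_simps)
  with fit have basic: "W\<^sup>2 \<le> 2 * (\<Sum>i<n. (y i - (X *\<^sub>v \<theta>) $ i) * (X *\<^sub>v (u - \<theta>)) $ i) + \<epsilon>" by simp
  have "(\<Sum>i<n. (y i - (X *\<^sub>v \<theta>) $ i) * (X *\<^sub>v (u - \<theta>)) $ i)
      = (\<Sum>i<n. \<Sum>j<d. (u - \<theta>) $ j * (X $$ (i, j) * (y i - (X *\<^sub>v \<theta>) $ i)))"
    by (intro sum.cong refl) (simp only: lessThan_iff mult_mat_vec_nth[OF X car(3)] sum_distrib_left ac_simps)
  also have "\<dots> = (\<Sum>j<d. (u - \<theta>) $ j * z j)"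
    unfolding z_def sum_distrib_left by (rule sum.swap)
  also have "\<dots> = (\<Sum>j\<in>?supp u \<union> ?supp \<theta>. (u - \<theta>) $ j * z j)"
    using car by (intro sum.mono_neutral_right) auto
  also have "\<dots> \<le> (\<Sum>j\<in>?supp u \<union> ?supp \<theta>. \<bar>(u - \<theta>) $ j\<bar> * \<bar>z j\<bar>)"
    by (intro sum_mono) (metis abs_ge_self abs_mult)
  also have "\<dots> \<le> L2_set (\<lambda>j. (u - \<theta>) $ j) (?supp u \<union> ?supp \<theta>) * L2_set z (?supp u \<union> ?supp \<theta>)"
    by (rule L2_set_mult_ineq)
  \<comment> \<open>The union of the supports may have more than \<open>s\<close> elements, so
    \<open>M\<close> is applied to each support separately, at the cost of the factor 2.\<close>
  also have "\<dots> \<le> vnorm (u - \<theta>) * sqrt (2 * M)"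
  proof (intro mult_mono)
    show "L2_set (\<lambda>j. (u - \<theta>) $ j) (?supp u \<union> ?supp \<theta>) \<le> vnorm (u - \<theta>)"
      unfolding vnorm_def L2_set_def using car by (intro real_sqrt_le_mono sum_mono2) auto
    have "(\<Sum>j\<in>?supp u \<union> ?supp \<theta>. (z j)\<^sup>2) \<le> (\<Sum>j\<in>?supp u. (z j)\<^sup>2) + (\<Sum>j\<in>?supp \<theta>. (z j)\<^sup>2)"
      by (subst sum.union_inter[symmetric]) (auto intro: sum_nonneg)
    also have "\<dots> \<le> M + M"
      using M[of "?supp u"] M[of "?supp \<theta>"] sparse car
      by (intro add_mono) (auto simp: score_def z_def vnorm0_def)
    finally show "L2_set z (?supp u \<union> ?supp \<theta>) \<le> sqrt (2 * M)"
      unfolding L2_set_def by (intro real_sqrt_le_mono) simp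
  qed (auto simp: L2_set_nonneg)
  also have "\<dots> \<le> W / (c * sqrt (real n)) * sqrt (2 * M)"
  proof (intro mult_right_mono)
    have "vnorm0 (u - \<theta>) \<le> 2 * s" using vnorm0_minus_le[OF car(1,2)] sparse by simp
    from lower[OF car(3) this] show "vnorm (u - \<theta>) \<le> W / (c * sqrt (real n))"
      using c n by (simp add: W_def field_simps)
    \<comment> \<open>The empty set of columns shows that \<open>M\<close> is nonnegative.\<close>
    have "0 \<le> score \<theta> {} y" by (simp add: score_def)
    also have "\<dots> \<le> M" by (rule M) auto
    finally show "0 \<le> sqrt (2 * M)" by simp
  qed
  finally have inner: "(\<Sum>i<n. (y i - (X *\<^sub>v \<theta>) $ i) * (X *\<^sub>v (u - \<theta>)) $ i)
      \<le> W * (sqrt (2 * M) / (c * sqrt (real n)))" by simp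
  define b where "b = sqrt (2 * M) / (c * sqrt (real n))"
  have M0: "0 \<le> M" using M[of "{}"] by (simp add: score_def)
  have "W\<^sup>2 \<le> 2 * (W * b) + \<epsilon>" using basic inner by (simp add: b_def)
  \<comment> \<open>Half of the squared \<open>W\<close> is absorbed into the left side of the basic
    inequality.\<close>
  moreover have "2 * (W * b) \<le> W\<^sup>2 / 2 + 2 * b\<^sup>2"
    using zero_le_power2[of "W - 2 * b"] by (simp add: power2_eq_square algebra_simps)
  ultimately have "W\<^sup>2 \<le> 4 * b\<^sup>2 + 2 * \<epsilon>" by linarith
  also have "b\<^sup>2 = 2 * M / (c\<^sup>2 * real n)" using M0 n by (simp add: b_def power_divide power_mult_distrib)
  finally have "W\<^sup>2 / real n \<le> (4 * (2 * M / (c\<^sup>2 * real n)) + 2 * \<epsilon>) / real n"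
    by (rule divide_right_mono) simp
  then show ?thesis
    by (simp add: pred_loss_alt W_def[symmetric] add_divide_distrib power2_eq_square mult.assoc)
qed

text \<open>Least squares is run with tolerance \<open>\<sigma>\<^sup>2\<close>, which adds only a
  multiple of \<open>\<sigma>\<^sup>2 / n\<close> and is absorbed because
  \<open>ln (1 / \<delta>) \<ge> 1\<close>. The term \<open>s * ln (sqrt 2)\<close> is at most the
  complexity, which doubles 32 to 64.\<close>

lemma quantile_upper_bound:
  assumes \<delta>: "0 < \<delta>" "\<delta> \<le> 1/4"
  shows "sparse_regression_quantile \<delta> X s \<sigma> \<le> ennreal ((64 * K\<^sup>2 / c\<^sup>2 + 2) *
     (\<sigma>\<^sup>2 * ((real s * ln (exp 1 * real d / real s) + ln (1 / \<delta>)) / real n)))"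
proof -
  let ?h = "real s * ln (exp 1 * real d / real s)"
  let ?S = "PiM {..<n} (\<lambda>_. borel :: real measure)"
  let ?r = "8 * score_bound \<delta> / (c\<^sup>2 * (real n)\<^sup>2) + 2 * \<sigma>\<^sup>2 / real n"
  obtain e :: "nat \<Rightarrow> real vec" and idx where e: "\<And>k. e k \<in> sparse_vecs d s"
    and idx[measurable]: "idx \<in> measurable ?S (count_space UNIV)"
    and fit: "\<And>y \<theta>. \<theta> \<in> sparse_vecs d s \<Longrightarrow> rss (e (idx y)) y \<le> rss \<theta> y + \<sigma>\<^sup>2"
    using near_least_squares_exists[of "\<sigma>\<^sup>2"] \<sigma> by auto
  have L: "1 \<le> ln (1 / \<delta>)"
  proof -
    have "4 \<le> 1 / \<delta>" using \<delta> by (simp add: field_simps)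
    then have "exp 1 \<le> 1 / \<delta>" using exp_le by linarith
    then show ?thesis using \<delta> by (simp add: ln_ge_iff)
  qed
  have h: "real s \<le> ?h"
  proof -
    have "1 \<le> ln (exp 1 * real d / real s)" using s by (subst ln_ge_iff) (auto simp: field_simps)
    from mult_left_mono[OF this, of "real s"] show ?thesis by simp
  qed
  have "ln (sqrt 2) \<le> (1::real)" using ln_sqrt[of 2] ln_le_minus_one[of 2] by simp
  from mult_left_mono[OF this, of "real s"] have t: "real s * ln (sqrt 2) \<le> real s" by simp
  have t0: "0 \<le> real s * ln (sqrt 2)" by simp
  have log_nonneg: "0 \<le> ?h + real s * ln (sqrt 2) + ln (1 / \<delta>)"
    using h L t0 by linarith
  have log_le: "?h + real s * ln (sqrt 2) + ln (1 / \<delta>) \<le> 2 * (?h + ln (1 / \<delta>))"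
    using order_trans[OF t h] L by simp
  have r0: "0 \<le> ?r" using log_nonneg by (simp add: score_bound_def)
  have "sparse_regression_quantile \<delta> X s \<sigma> \<le> ennreal ?r"
    unfolding sparse_regression_quantile_alt
  proof (rule minimax_quantile_le[where est="\<lambda>y. e (idx y)"])
    show "(\<lambda>y. e (idx y)) \<in> measurable ?S (pm_borel (sparse_vecs d s) (\<lambda>\<theta> \<theta>'. vnorm (\<theta> - \<theta>')))"
    proof (rule measurable_pm_borel_countable[where Q="range e"])
      fix q show "{y \<in> space ?S. e (idx y) = q} \<in> sets ?S" by measurable
    qed (use e in auto)
    fix \<theta> P assume \<theta>: "\<theta> \<in> sparse_vecs d s" and P: "P \<in> {law \<theta>}"
    interpret P: prob_space "law \<theta>" by (rule prob_space_gauss[OF \<sigma>])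
    \<comment> \<open>The loss event depends on the sample only through \<open>idx y\<close>, so
      this makes it measurable and monotonicity of the measure applies.\<close>
    have [measurable]: "idx \<in> measurable (law \<theta>) (count_space UNIV)"
      using idx by (simp add: measurable_gauss)
    have "1 - \<delta> \<le> measure (law \<theta>)
      {y \<in> space (law \<theta>). \<forall>T. T \<subseteq> {..<d} \<and> card T \<le> s \<longrightarrow> score \<theta> T y \<le> score_bound \<delta>}"
      by (rule score_uniform_tail[OF \<delta>(1)])
    also have "\<dots> \<le> measure (law \<theta>) {y \<in> space (law \<theta>). pred_loss X (e (idx y)) \<theta> \<le> ?r}"
      by (intro P.finite_measure_mono) (auto intro!: least_squares_loss e \<theta> fit)
    finally show "1 - \<delta> \<le> measure P {y \<in> space P. pred_loss X (e (idx y)) \<theta> \<le> ?r}" using P by simp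
  qed (rule r0)
  moreover have "?r \<le> (64 * K\<^sup>2 / c\<^sup>2 + 2) * (\<sigma>\<^sup>2 * ((?h + ln (1 / \<delta>)) / real n))"
  proof -
    have "8 * score_bound \<delta> / (c\<^sup>2 * (real n)\<^sup>2)
      = 32 * K\<^sup>2 / c\<^sup>2 * (\<sigma>\<^sup>2 / real n) * (?h + real s * ln (sqrt 2) + ln (1 / \<delta>))"
      using n by (simp add: score_bound_def power2_eq_square ac_simps)
    also have "\<dots> \<le> 32 * K\<^sup>2 / c\<^sup>2 * (\<sigma>\<^sup>2 / real n) * (2 * (?h + ln (1 / \<delta>)))"
      by (intro mult_left_mono log_le) simp
    also have "\<dots> = 64 * K\<^sup>2 / c\<^sup>2 * (\<sigma>\<^sup>2 * ((?h + ln (1 / \<delta>)) / real n))"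
    proof -
      have "32 * k * (v / m) * (2 * x) = 64 * k * (v * (x / m))" for k v m x :: real by simp
      from this[of "K\<^sup>2 / c\<^sup>2"] show ?thesis by (simp only: times_divide_eq_right)
    qed
    finally have 1: "8 * score_bound \<delta> / (c\<^sup>2 * (real n)\<^sup>2)
      \<le> 64 * K\<^sup>2 / c\<^sup>2 * (\<sigma>\<^sup>2 * ((?h + ln (1 / \<delta>)) / real n))" .
    have "2 * \<sigma>\<^sup>2 / real n * 1 \<le> 2 * \<sigma>\<^sup>2 / real n * (?h + ln (1 / \<delta>))"
      using h L by (intro mult_left_mono) auto
    then have "2 * \<sigma>\<^sup>2 / real n \<le> 2 * (\<sigma>\<^sup>2 * ((?h + ln (1 / \<delta>)) / real n))" by simp
    from add_mono[OF 1 this] show ?thesis by (simp only: distrib_right)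
  qed
  ultimately show ?thesis by (meson ennreal_leI order_trans)
qed

end

subsection \<open>The regression problem\<close>

text \<open>The cone is taken at level \<open>max s 2\<close>, which is at most \<open>d\<close>
  since \<open>d \<ge> 2\<close>. Enlarging \<open>C\<close> to \<open>max C 1\<close> gives the
  same upper constant as the case of one column.\<close>

lemma sparse_design_from_wre:
  assumes n: "0 < n" and s: "1 \<le> s" "s \<le> d" and X: "X \<in> carrier_mat n d"
    and c: "0 < c" and C: "0 < C" and \<sigma>: "0 < \<sigma>" and d: "2 \<le> d"
    and wre: "c \<le> wre_const X \<sigma> (max s 2) 3"
    and op: "Max ((\<lambda>T. op_norm (select_cols X T)) ` {T. T \<subseteq> {..<d} \<and> card T \<le> max s 2}) \<le> C * sqrt (real n)"
  shows "sparse_design n d s X c (max C 1) \<sigma>"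
proof
  show "c * sqrt (real n) * vnorm v \<le> vnorm (X *\<^sub>v v)" if "v \<in> carrier_vec d" "vnorm0 v \<le> 2 * s" for v
    using wre_const_sparse_lower[OF X n that s(1) _ _ _ wre] s d \<sigma> by simp
  fix T :: "nat set" and g :: "nat \<Rightarrow> real" assume T: "T \<subseteq> {..<d}" "card T \<le> s"
  have "finite {T. T \<subseteq> {..<d} \<and> card T \<le> max s 2}"
    by (rule finite_subset[of _ "Pow {..<d}"]) auto
  then have "op_norm (select_cols X T)
      \<le> Max ((\<lambda>T. op_norm (select_cols X T)) ` {T. T \<subseteq> {..<d} \<and> card T \<le> max s 2})"
    using T by (intro Max_ge) auto
  also note op
  also have "C * sqrt (real n) \<le> max C 1 * sqrt (real n)" by (intro mult_right_mono) auto
  finally show "(\<Sum>i<n. (\<Sum>j\<in>T. X $$ (i, j) * g j)\<^sup>2) \<le> (max C 1)\<^sup>2 * real n * (\<Sum>j\<in>T. (g j)\<^sup>2)"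
    using select_cols_sum_le[OF X T(1), of "max C 1 * sqrt (real n)" g] by (simp add: power_mult_distrib)
qed (use assms in auto)

text \<open>With one column, \<open>vnorm (X *\<^sub>v v)\<close> is the column norm times
  \<open>vnorm v\<close>, so both comparisons reduce to the two bounds on that norm.\<close>

lemma sparse_design_one_column:
  assumes n: "0 < n" and X: "X \<in> carrier_mat n 1" and c: "0 < c" and K: "1 \<le> K" and \<sigma>: "0 < \<sigma>"
    and up: "vnorm (col X 0) \<le> sqrt (real n)" and low: "c * sqrt (real n) \<le> vnorm (col X 0)"
  shows "sparse_design n 1 1 X c K \<sigma>"
proof
  have col: "(vnorm (col X 0))\<^sup>2 = (\<Sum>i<n. (X $$ (i, 0))\<^sup>2)"
    using X by (simp add: vnorm_power2)
  show "c * sqrt (real n) * vnorm v \<le> vnorm (X *\<^sub>v v)" if v: "v \<in> carrier_vec 1" for v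
  proof -
    have "(vnorm v)\<^sup>2 = (v $ 0)\<^sup>2" using v by (simp add: vnorm_power2)
    then have "(vnorm (X *\<^sub>v v))\<^sup>2 = (vnorm (col X 0) * vnorm v)\<^sup>2"
      unfolding vnorm_mult_mat_vec_power2[OF X v] power_mult_distrib col
      by (simp add: power_mult_distrib sum_distrib_right)
    then have "vnorm (X *\<^sub>v v) = vnorm (col X 0) * vnorm v" by (simp add: power2_eq_iff_nonneg)
    then show ?thesis using low by (simp add: mult_right_mono)
  qed
  fix T :: "nat set" and g :: "nat \<Rightarrow> real" assume "T \<subseteq> {..<1}"
  then consider "T = {}" | "T = {0}" by auto
  then show "(\<Sum>i<n. (\<Sum>j\<in>T. X $$ (i, j) * g j)\<^sup>2) \<le> K\<^sup>2 * real n * (\<Sum>j\<in>T. (g j)\<^sup>2)"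
  proof cases
    case 2
    have "(vnorm (col X 0))\<^sup>2 \<le> (sqrt (real n))\<^sup>2" using up by (intro power_mono) auto
    also have "\<dots> \<le> K\<^sup>2 * real n"
      using mult_right_mono[OF one_le_power[OF K, of 2], of "real n"] by simp
    finally have "(vnorm (col X 0))\<^sup>2 * (g 0)\<^sup>2 \<le> K\<^sup>2 * real n * (g 0)\<^sup>2" by (rule mult_right_mono) simp
    then show ?thesis using 2 by (simp add: col sum_distrib_right power_mult_distrib)
  qed simp
qed (use assms in auto)

theorem proposition14:
  fixes c C :: real
  assumes "c > 0" and "C > 0"
  shows "\<exists>k1 k2 :: real. k1 > 0 \<and> k2 > 0 \<and>
    (\<forall>(n::nat) (d::nat) (s::nat) (\<delta>::real) (\<sigma>::real) (X::real mat).
       1 \<le> n \<longrightarrow> 1 \<le> d \<longrightarrow> s \<in> {1..d} \<longrightarrow> 0 < \<delta> \<longrightarrow> \<delta> \<le> 1/4 \<longrightarrow> 0 < \<sigma> \<longrightarrow>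
       X \<in> carrier_mat n d \<longrightarrow>
       (\<forall>j<d. vnorm (col X j) \<le> sqrt (real n)) \<longrightarrow>
       (d = 1 \<longrightarrow> vnorm (col X 0) \<ge> c * sqrt (real n)) \<longrightarrow>
       (d \<ge> 2 \<longrightarrow> wre_const X \<sigma> (max s 2) 3 \<ge> c \<and>
          Max ((\<lambda>T. op_norm (select_cols X T)) ` {T. T \<subseteq> {..<d} \<and> card T \<le> max s 2})
            \<le> C * sqrt (real n)) \<longrightarrow>
       (let rate = \<sigma>\<^sup>2 * ((real s * ln (exp 1 * real d / real s) + ln (1 / \<delta>)) / real n) in
          ennreal (k1 * rate) \<le> sparse_regression_quantile \<delta> X s \<sigma> \<and>
          sparse_regression_quantile \<delta> X s \<sigma> \<le> ennreal (k2 * rate)))"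
proof -
  define K where "K = max C 1"
  \<comment> \<open>The minimum meets both conditions on \<open>k\<close> in
    \<open>quantile_lower_bound\<close>; \<open>k1\<close> and \<open>k2\<close> depend on
    \<open>c\<close> and \<open>C\<close> alone.\<close>
  define k1 where "k1 = min (1 / 2080) (c\<^sup>2 / (24576 * K\<^sup>2))"
  define k2 where "k2 = 64 * K\<^sup>2 / c\<^sup>2 + 2"
  have K: "1 \<le> K" by (simp add: K_def)
  have k1: "0 < k1" "k1 \<le> 1 / 2080" "k1 \<le> c\<^sup>2 / (24576 * K\<^sup>2)"
    using assms K by (auto simp: k1_def)
  have k2: "0 < k2" unfolding k2_def by (intro add_nonneg_pos) auto
  have bounds: "ennreal (k1 * (\<sigma>\<^sup>2 * ((real s * ln (exp 1 * real d / real s) + ln (1 / \<delta>)) / real n)))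
        \<le> sparse_regression_quantile \<delta> X s \<sigma> \<and>
      sparse_regression_quantile \<delta> X s \<sigma>
        \<le> ennreal (k2 * (\<sigma>\<^sup>2 * ((real s * ln (exp 1 * real d / real s) + ln (1 / \<delta>)) / real n)))"
    if n: "1 \<le> n" and s: "s \<in> {1..d}" and \<delta>: "0 < \<delta>" "\<delta> \<le> 1/4" and \<sigma>: "0 < \<sigma>"
      and X: "X \<in> carrier_mat n d" and cols: "\<forall>j<d. vnorm (col X j) \<le> sqrt (real n)"
      and one: "d = 1 \<longrightarrow> vnorm (col X 0) \<ge> c * sqrt (real n)"
      and two: "d \<ge> 2 \<longrightarrow> wre_const X \<sigma> (max s 2) 3 \<ge> c \<and>
          Max ((\<lambda>T. op_norm (select_cols X T)) ` {T. T \<subseteq> {..<d} \<and> card T \<le> max s 2})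
            \<le> C * sqrt (real n)"
    for n d s :: nat and \<delta> \<sigma> :: real and X :: "real mat"
  proof -
    have "sparse_design n d s X c K \<sigma>"
    proof (cases "d = 1")
      case True
      then have "s = 1" using s by simp
      with True show ?thesis using sparse_design_one_column[of n X c K \<sigma>] n X assms K \<sigma> cols one by simp
    next
      case False
      then have "2 \<le> d" using s by auto
      then show ?thesis unfolding K_def using n s X assms \<sigma> two by (intro sparse_design_from_wre) auto
    qed
    then interpret sparse_design n d s X c K \<sigma> .
    show ?thesis
      using quantile_lower_bound[OF \<delta> less_imp_le[OF k1(1)] k1(2,3)] quantile_upper_bound[OF \<delta>]
      by (simp add: k2_def)
  qed
  show ?thesis
    by (rule exI[of _ k1], rule exI[of _ k2]) (use k1(1) k2 bounds in \<open>simp only: Let_def, blast\<close>)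
qed

end
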